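(* Let $0<\kappa<1$. Let $\Omega\subset S^{n-1}$ be a domain with $|\partial\Omega|=0$, and let $D\subset\mathbb R^n$ be contained in an $(n-1)$-dimensional hypersurface, with $\overline D$ compact and $0\notin\overline D$. Assume: (H1) there is $\tau$ with $0<\tau<1-\kappa$ such that $x\cdot P\ge(\kappa+\tau)|P|$ for all $x\in\overline\Omega$ and all $P\in\overline D$; (H2) $0<r_0\le\dfrac{\tau}{1+\kappa}\,\mathrm{dist}(0,\overline D)$ and, with $Q_{r_0}=\{tx:x\in\overline\Omega,\ 0<t\le r_0\}$, for each $m\in S^{n-1}$ and each $X\in Q_{r_0}$ the set $\overline D\cap\{X+tm:t\ge0\}$ contains at most one point. Let $\mu$ be a Radon measure on $\overline D$ and let $f\in L^1(\Omega)$ with $f>0$ a.e. satisfy the energy conservation condition $$\int_\Omega f(x)\,dx=\mu(\overline D).$$ Then, given $X_0\in Q_{r_0}$ with $0<|X_0|<\left(\dfrac{1-\kappa}{1+\kappa}\right)^3r_0$, there exists a weak solution of the near field refractor problem (with emitting intensity $f$ and prescribed refracted intensity $\mu$) passing through $X_0$; that is, there is a near field refractor $\mathcal S=\{\rho(x)x:x\in\overline\Omega\}$ with $\mathcal M_{\mathcal S,f}(F)=\mu(F)$ for every Borel set $F\subset\overline D$ and $X_0\in\mathcal S$.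
   Context: $n\ge2$; $S^{n-1}$ is the unit sphere in $\mathbb R^n$, $|\cdot|$ of subsets of the sphere and $dx$ refer to surface measure on the sphere. $\kappa=n_2/n_1$ is the ratio of the refractive indices. For $P\in\mathbb R^n$ and $\kappa|P|<b<|P|$, let $$h(x,P,b)=\frac{(b-\kappa^2x\cdot P)-\sqrt{(b-\kappa^2x\cdot P)^2-(1-\kappa^2)(b^2-\kappa^2|P|^2)}}{1-\kappa^2},\qquad x\in S^{n-1},$$ and define the refracting oval $\mathcal O(P,b)=\{h(x,P,b)x:x\in S^{n-1},\ x\cdot P\ge b\}$. A surface $\mathcal S=\{\rho(x)x:x\in\overline\Omega\}\subset Q_{r_0}$ ($\rho>0$) is a near field refractor if for each $y\in\overline\Omega$ there exist $P\in\overline D$ and $b$ such that $\mathcal O(P,b)$ supports $\mathcal S$ at $\rho(y)y$, i.e. $x\cdot P\ge b$ and $\rho(x)\le h(x,P,b)$ for all $x\in\overline\Omega$, with equality $\rho(y)=h(y,P,b)$. The refractor mapping is $\mathcal R_{\mathcal S}(x)=\{P\in\overline D:\text{ there is a supporting oval }\mathcal O(P,b)\text{ to }\mathcal S\text{ at }\rho(x)x\}$, $x\in\overline\Omega$. For $F\subset\overline D$, $\mathcal R_{\mathcal S}^{-1}(F)=\{x\in\overline\Omega:\mathcal R_{\mathcal S}(x)\cap F\neq\emptyset\}$, and the near field refractor measure is $\mathcal M_{\mathcal S,f}(F)=\int_{\mathcal R_{\mathcal S}^{-1}(F)}f\,dx$ (a Radon measure on $\overline D$). A near field refractor $\mathcal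 S$ is a weak solution of the near field refractor problem for $\kappa<1$ with emitting intensity $f$ on $\overline\Omega$ and prescribed refracted intensity $\mu$ on $\overline D$ if $\mathcal M_{\mathcal S,f}(F)=\mu(F)$ for every Borel $F\subset\overline D$. *)

theory Defs
  imports "HOL-Analysis.Analysis"
begin

text \<open>
  Surface measure on the unit sphere, given by polar coordinates: \<open>|A| = n \<cdot> vol {t x | x \<in> A, 0 < t \<le> 1}\<close>
  for Borel \<open>A\<close> (see \<open>emeasure_sphere_measure\<close> below). It is completed, because the preimage of a
  Borel set under the refractor mapping is in general Borel only up to a null set.
\<close>

definition sphere_measure :: "(real ^ 'n) measure" where
  "sphere_measure =
     completion (scale_measure (of_nat CARD('n))
       (distr (restrict_space lborel (cball 0 1 - {0})) (restrict_space borel (sphere 0 1))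
          (\<lambda>x. x /\<^sub>R norm x)))"

lemma space_sphere_measure [simp]: "space sphere_measure = sphere 0 1"
  by (simp add: sphere_measure_def space_restrict_space space_scale_measure)

lemma emeasure_sphere_measure:
  fixes A :: "(real ^ 'n) set"
  assumes "A \<in> sets borel" "A \<subseteq> sphere 0 1"
  shows "A \<in> sets sphere_measure"
    and "emeasure sphere_measure A
           = of_nat CARD('n) * emeasure lborel {t *\<^sub>R x | t x. x \<in> A \<and> 0 < t \<and> t \<le> 1}"
proof -
  let ?B = "restrict_space lborel (cball 0 1 - {0}) :: (real ^ 'n) measure"
  let ?S = "restrict_space borel (sphere 0 1) :: (real ^ 'n) measure"
  let ?D = "distr ?B ?S (\<lambda>x. x /\<^sub>R norm x)"
  have A: "A \<in> sets ?S"
    using assms by (auto simp: sets_restrict_space)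
  then have A': "A \<in> sets (scale_measure (of_nat CARD('n)) ?D)"
    by simp
  then show "A \<in> sets sphere_measure"
    unfolding sphere_measure_def by (rule sets_completionI_sets)
  have m: "(\<lambda>x. x /\<^sub>R norm x) \<in> measurable ?B ?S"
    by (intro measurable_restrict_space2 measurable_restrict_space1)
       (auto simp: space_restrict_space)
  have "(\<lambda>x. x /\<^sub>R norm x) -` A \<inter> space ?B = {t *\<^sub>R x | t x. x \<in> A \<and> 0 < t \<and> t \<le> 1}"
  proof (intro equalityI subsetI)
    fix y assume y: "y \<in> (\<lambda>x. x /\<^sub>R norm x) -` A \<inter> space ?B"
    then have "y = norm y *\<^sub>R (y /\<^sub>R norm y)" "0 < norm y" "norm y \<le> 1" "y /\<^sub>R norm y \<in> A"
      by (auto simp: space_restrict_space)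
    then show "y \<in> {t *\<^sub>R x | t x. x \<in> A \<and> 0 < t \<and> t \<le> 1}" by blast
  next
    fix y assume "y \<in> {t *\<^sub>R x | t x. x \<in> A \<and> 0 < t \<and> t \<le> 1}"
    then obtain t x where "y = t *\<^sub>R x" "x \<in> A" "0 < t" "t \<le> 1" by blast
    moreover from this have "norm x = 1" using assms(2) by auto
    ultimately show "y \<in> (\<lambda>x. x /\<^sub>R norm x) -` A \<inter> space ?B"
      by (auto simp: space_restrict_space)
  qed
  moreover from this have "{t *\<^sub>R x | t x. x \<in> A \<and> 0 < t \<and> t \<le> 1} \<subseteq> cball 0 1 - {0}"
    by (metis (no_types, lifting) Int_lower2 inf_top_right space_borel space_lborel space_restrict_space)
  ultimately have "emeasure ?D A = emeasure lborel {t *\<^sub>R x | t x. x \<in> A \<and> 0 < t \<and> t \<le> 1}"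
    by (simp only: emeasure_distr[OF m A]) (rule emeasure_restrict_space, auto)
  then show "emeasure sphere_measure A
      = of_nat CARD('n) * emeasure lborel {t *\<^sub>R x | t x. x \<in> A \<and> 0 < t \<and> t \<le> 1}"
    unfolding sphere_measure_def
    using A' by (simp add: emeasure_scale_measure)
qed

definition radon_measure_on :: "'a::topological_space set \<Rightarrow> 'a measure \<Rightarrow> bool" where
  "radon_measure_on K \<mu> \<longleftrightarrow>
     sets \<mu> = sets (restrict_space borel K) \<and>
     (\<forall>C. compact C \<and> C \<subseteq> K \<longrightarrow> emeasure \<mu> C < \<infinity>) \<and>
     (\<forall>E \<in> sets \<mu>. emeasure \<mu> E = (SUP C \<in> {C. compact C \<and> C \<subseteq> E}. emeasure \<mu> C))"

text \<open>A topological hypersurface: no smoothness is required.\<close>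

definition hypersurface :: "(real ^ 'n) set \<Rightarrow> bool" where
  "hypersurface \<Sigma> \<longleftrightarrow>
     (\<forall>p \<in> \<Sigma>. \<exists>U H V. openin (top_of_set \<Sigma>) U \<and> p \<in> U \<and>
        subspace (H :: (real ^ 'n) set) \<and> dim H = CARD('n) - 1 \<and>
        openin (top_of_set H) V \<and> U homeomorphic V)"

definition oval_radius :: "real \<Rightarrow> real ^ 'n \<Rightarrow> real \<Rightarrow> real ^ 'n \<Rightarrow> real" where
  "oval_radius \<kappa> P b x =
     ((b - \<kappa>\<^sup>2 * (x \<bullet> P))
       - sqrt ((b - \<kappa>\<^sup>2 * (x \<bullet> P))\<^sup>2 - (1 - \<kappa>\<^sup>2) * (b\<^sup>2 - \<kappa>\<^sup>2 * (norm P)\<^sup>2))) / (1 - \<kappa>\<^sup>2)"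

definition refracting_oval :: "real \<Rightarrow> real ^ 'n \<Rightarrow> real \<Rightarrow> (real ^ 'n) set" where
  "refracting_oval \<kappa> P b = {oval_radius \<kappa> P b x *\<^sub>R x | x. x \<in> sphere 0 1 \<and> x \<bullet> P \<ge> b}"

definition cone_region :: "(real ^ 'n) set \<Rightarrow> real \<Rightarrow> (real ^ 'n) set" where
  "cone_region \<Omega> r = {t *\<^sub>R x | t x. x \<in> closure \<Omega> \<and> 0 < t \<and> t \<le> r}"

text \<open>
  A surface \<open>{\<rho> x *\<^sub>R x | x \<in> closure \<Omega>}\<close> is represented by its radial function \<open>\<rho>\<close>; only the values
  of \<open>\<rho>\<close> on \<open>closure \<Omega>\<close> matter.
\<close>

definition radial_surface :: "(real ^ 'n) set \<Rightarrow> (real ^ 'n \<Rightarrow> real) \<Rightarrow> (real ^ 'n) set" where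
  "radial_surface \<Omega> \<rho> = {\<rho> x *\<^sub>R x | x. x \<in> closure \<Omega>}"

text \<open>The oval \<open>refracting_oval \<kappa> P b\<close> supports the surface with radial function \<open>\<rho>\<close> at \<open>\<rho> y *\<^sub>R y\<close>.\<close>

definition oval_supports ::
  "real \<Rightarrow> (real ^ 'n) set \<Rightarrow> real ^ 'n \<Rightarrow> real \<Rightarrow> (real ^ 'n \<Rightarrow> real) \<Rightarrow> real ^ 'n \<Rightarrow> bool" where
  "oval_supports \<kappa> \<Omega> P b \<rho> y \<longleftrightarrow>
     \<kappa> * norm P < b \<and> b < norm P \<and>
     (\<forall>x \<in> closure \<Omega>. x \<bullet> P \<ge> b \<and> \<rho> x \<le> oval_radius \<kappa> P b x) \<and>
     \<rho> y = oval_radius \<kappa> P b y"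

definition near_field_refractor ::
  "real \<Rightarrow> (real ^ 'n) set \<Rightarrow> (real ^ 'n) set \<Rightarrow> real \<Rightarrow> (real ^ 'n \<Rightarrow> real) \<Rightarrow> bool" where
  "near_field_refractor \<kappa> \<Omega> D r\<^sub>0 \<rho> \<longleftrightarrow>
     (\<forall>x \<in> closure \<Omega>. 0 < \<rho> x) \<and>
     radial_surface \<Omega> \<rho> \<subseteq> cone_region \<Omega> r\<^sub>0 \<and>
     (\<forall>y \<in> closure \<Omega>. \<exists>P \<in> closure D. \<exists>b. oval_supports \<kappa> \<Omega> P b \<rho> y)"

definition refractor_map ::
  "real \<Rightarrow> (real ^ 'n) set \<Rightarrow> (real ^ 'n) set \<Rightarrow> (real ^ 'n \<Rightarrow> real) \<Rightarrow> real ^ 'n \<Rightarrow> (real ^ 'n) set" where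
  "refractor_map \<kappa> \<Omega> D \<rho> x = {P \<in> closure D. \<exists>b. oval_supports \<kappa> \<Omega> P b \<rho> x}"

definition refractor_preimage ::
  "real \<Rightarrow> (real ^ 'n) set \<Rightarrow> (real ^ 'n) set \<Rightarrow> (real ^ 'n \<Rightarrow> real) \<Rightarrow> (real ^ 'n) set \<Rightarrow> (real ^ 'n) set" where
  "refractor_preimage \<kappa> \<Omega> D \<rho> F = {x \<in> closure \<Omega>. refractor_map \<kappa> \<Omega> D \<rho> x \<inter> F \<noteq> {}}"

definition refractor_measure ::
  "real \<Rightarrow> (real ^ 'n) set \<Rightarrow> (real ^ 'n) set \<Rightarrow> (real ^ 'n \<Rightarrow> real) \<Rightarrow> (real ^ 'n \<Rightarrow> real) \<Rightarrow>
    (real ^ 'n) set \<Rightarrow> real" where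
  "refractor_measure \<kappa> \<Omega> D f \<rho> F =
     (LINT x:refractor_preimage \<kappa> \<Omega> D \<rho> F|sphere_measure. f x)"

text \<open>
  The measurability clause says that the integral defining \<open>refractor_measure\<close> makes sense; without
  it, that integral could take the default value \<open>0\<close>.
\<close>

definition weak_solution ::
  "real \<Rightarrow> (real ^ 'n) set \<Rightarrow> (real ^ 'n) set \<Rightarrow> real \<Rightarrow> (real ^ 'n \<Rightarrow> real) \<Rightarrow> (real ^ 'n) measure \<Rightarrow>
    (real ^ 'n \<Rightarrow> real) \<Rightarrow> bool" where
  "weak_solution \<kappa> \<Omega> D r\<^sub>0 f \<mu> \<rho> \<longleftrightarrow>
     near_field_refractor \<kappa> \<Omega> D r\<^sub>0 \<rho> \<and>
     (\<forall>F. F \<in> sets borel \<and> F \<subseteq> closure D \<longrightarrow>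
        refractor_preimage \<kappa> \<Omega> D \<rho> F \<in> sets sphere_measure \<and>
        refractor_measure \<kappa> \<Omega> D f \<rho> F = measure \<mu> F)"

end

theory Submission
  imports Defs "HOL-Complex_Analysis.Great_Picard"
begin

text \<open>
  The oval with focus \<open>P\<close> and level \<open>b\<close> is the part visible from the origin of the level set
  \<open>|X| + \<kappa> |X - P| = b\<close> of the optical path from the origin to \<open>P\<close> through
  \<open>X\<close>. Along a ray from the origin the optical path increases strictly, so a surface lies inside an oval
  exactly when its optical paths to \<open>P\<close> are at most \<open>b\<close>. Inside \<open>Q\<close> of radius
  \<open>r\<^sub>0\<close> the side conditions on \<open>b\<close> hold by themselves, and \<open>P\<close> belongs to
  the refractor mapping at \<open>y\<close> iff the optical path to \<open>P\<close> is maximal over the surface at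
  the point in direction \<open>y\<close>: then \<open>P\<close> is called active at \<open>y\<close>.

  Almost every direction has only one active target. The optical path is convex in \<open>X\<close>, so each active
  target gives a hyperplane that supports the surface at the point in question. By Snell's law and the visibility
  condition different targets give different hyperplanes. The normalized supporting covectors form a monotone
  set-valued map with convex values, and such a map is multivalued only on a negligible set
  (\<open>negligible_multivalued_monotone\<close>, \<open>negligible_cone_multi_active\<close>).

  For finitely many targets one looks at the lower envelope of ovals with levels \<open>b P\<close>. Lowering one
  level enlarges the cell of that target and shrinks all the others, and the energy of a cell depends continuously on
  the levels. Hence the level vectors for which no target receives too much energy form a set closed under minima, and
  its least element gives every target exactly its share (\<open>exists_levels_with_masses\<close>). To make the set
  of admissible levels bounded below and to control where the surface passes, the energy is multiplied by a cutoff
  that is \<open>1\<close> well below and \<open>0\<close> above a steep spike that points to the origin and has its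
  tip slightly beyond \<open>X\<^sub>0\<close>. If the prescribed shares fall short of the total energy by a tiny
  amount, the surface has to cross the spike, but only near its tip (\<open>exists_discrete_refractor\<close>).

  Refractors satisfy a Harnack inequality and are equi-Lipschitz. So the surfaces for finite approximations of
  \<open>\<mu>\<close> converge uniformly along a subsequence, the limit is a refractor through
  \<open>X\<^sub>0\<close>, and for almost every direction the active targets converge to the active target of the
  limit. Thus the limit pushes \<open>f dx\<close> forward to \<open>\<mu>\<close> (\<open>exists_refractor\<close>).
\<close>

section \<open>Optical path and refracting ovals\<close>

text \<open>
  The travel time from the origin through \<open>X\<close> to \<open>P\<close>, in units in which the first medium has
  index \<open>1\<close>.
\<close>

definition optical_path :: "real \<Rightarrow> 'a::real_normed_vector \<Rightarrow> 'a \<Rightarrow> real" where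
  "optical_path \<kappa> X P = norm X + \<kappa> * norm (X - P)"

text \<open>
  The term \<open>\<kappa> |X - P|\<close> is \<open>\<kappa>\<close>-Lipschitz, so along a ray it undoes at most the
  fraction \<open>\<kappa>\<close> of the growth of \<open>|X|\<close>.
\<close>

lemma optical_path_diff_le:
  fixes x P :: "'a::real_normed_vector"
  assumes "norm x = 1" "0 \<le> \<kappa>" "s \<le> t"
  shows "(1 - \<kappa>) * (t - s) \<le> (t + \<kappa> * norm (t *\<^sub>R x - P)) - (s + \<kappa> * norm (s *\<^sub>R x - P))"
proof -
  have "norm (s *\<^sub>R x - P) \<le> norm (t *\<^sub>R x - P) + norm (s *\<^sub>R x - t *\<^sub>R x)"
    using norm_triangle_ineq[of "t *\<^sub>R x - P" "s *\<^sub>R x - t *\<^sub>R x"] by simp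
  also have "norm (s *\<^sub>R x - t *\<^sub>R x) = t - s"
    using assms by (simp flip: scaleR_left.diff)
  finally have "\<kappa> * norm (s *\<^sub>R x - P) \<le> \<kappa> * (norm (t *\<^sub>R x - P) + (t - s))"
    using assms(2) mult_left_mono by blast
  then show ?thesis
    by (simp add: algebra_simps)
qed

lemma optical_path_ray_le_iff:
  fixes x P :: "'a::real_normed_vector"
  assumes "norm x = 1" "0 \<le> \<kappa>" "\<kappa> < 1" "0 \<le> s" "0 \<le> t"
  shows "optical_path \<kappa> (s *\<^sub>R x) P \<le> optical_path \<kappa> (t *\<^sub>R x) P \<longleftrightarrow> s \<le> t"
proof -
  have *: "optical_path \<kappa> (s *\<^sub>R x) P < optical_path \<kappa> (t *\<^sub>R x) P" if "s < t" "0 \<le> s" for s t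
  proof -
    have "0 < (1 - \<kappa>) * (t - s)"
      using that assms by simp
    also have "\<dots> \<le> (t + \<kappa> * norm (t *\<^sub>R x - P)) - (s + \<kappa> * norm (s *\<^sub>R x - P))"
      using assms that by (intro optical_path_diff_le) auto
    finally show ?thesis
      using that assms by (simp add: optical_path_def algebra_simps)
  qed
  show ?thesis
    using *[of s t] *[of t s] assms by (cases s t rule: linorder_cases) auto
qed

text \<open>
  Both bounds come from the triangle inequality for \<open>0\<close>, \<open>X\<close>, \<open>P\<close>. Together
  they confine an oval to a spherical shell with ratio of radii \<open>(1 + \<kappa>) / (1 - \<kappa>)\<close>.
\<close>

lemma optical_path_bounds:
  assumes "0 \<le> \<kappa>"
  shows "\<kappa> * norm P + (1 - \<kappa>) * norm X \<le> optical_path \<kappa> X P"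
    and "optical_path \<kappa> X P \<le> \<kappa> * norm P + (1 + \<kappa>) * norm X"
proof -
  have "\<kappa> * norm P \<le> \<kappa> * (norm (X - P) + norm X)"
    using norm_triangle_ineq[of "P - X" X] assms by (intro mult_left_mono) (auto simp: norm_minus_commute)
  then show "\<kappa> * norm P + (1 - \<kappa>) * norm X \<le> optical_path \<kappa> X P"
    by (simp add: optical_path_def algebra_simps)
  have "\<kappa> * norm (X - P) \<le> \<kappa> * (norm X + norm P)"
    using assms by (intro mult_left_mono norm_triangle_ineq4)
  then show "optical_path \<kappa> X P \<le> \<kappa> * norm P + (1 + \<kappa>) * norm X"
    by (simp add: optical_path_def algebra_simps)
qed

text \<open>
  Squaring \<open>\<kappa> |r x - P| = b - r\<close> gives a quadratic equation for \<open>r\<close>, and the radial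
  function of the oval is its smaller root. Only that root satisfies \<open>r \<le> b\<close>, which makes the
  squaring reversible.
\<close>

lemma oval_radius_solves:
  fixes x P :: "real ^ 'n"
  assumes x: "norm x = 1" and \<kappa>: "0 < \<kappa>" "\<kappa> < 1" and b: "\<kappa> * norm P \<le> b"
  shows "0 \<le> oval_radius \<kappa> P b x" and "optical_path \<kappa> (oval_radius \<kappa> P b x *\<^sub>R x) P = b"
proof -
  define s where "s = x \<bullet> P"
  define p where "p = norm P"
  define B where "B = b - \<kappa>\<^sup>2 * s"
  define \<Delta> where "\<Delta> = B\<^sup>2 - (1 - \<kappa>\<^sup>2) * (b\<^sup>2 - \<kappa>\<^sup>2 * p\<^sup>2)"
  define r where "r = (B - sqrt \<Delta>) / (1 - \<kappa>\<^sup>2)"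
  have r_eq: "oval_radius \<kappa> P b x = r"
    by (simp add: oval_radius_def r_def \<Delta>_def B_def s_def p_def)
  have k2: "0 < \<kappa>\<^sup>2" "0 < 1 - \<kappa>\<^sup>2" "\<kappa>\<^sup>2 < \<kappa>"
    using \<kappa> mult_strict_right_mono[of \<kappa> 1 \<kappa>] less_trans[of "\<kappa> * \<kappa>" \<kappa> 1]
    by (auto simp: power2_eq_square)
  have sp: "\<bar>s\<bar> \<le> p"
    using Cauchy_Schwarz_ineq2[of x P] x by (simp add: s_def p_def)
  have sp2: "s\<^sup>2 \<le> p\<^sup>2"
    using sp by (metis abs_ge_zero power2_abs power_mono)
  have p0: "0 \<le> p" by (simp add: p_def)
  have b0: "\<kappa> * p \<le> b" "0 \<le> b"
    using b p0 \<kappa> by (auto simp: p_def intro: order_trans[rotated])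
  \<comment> \<open>This form of the discriminant is manifestly nonnegative, since \<open>s\<^sup>2 \<le> p\<^sup>2\<close>.\<close>
  have \<Delta>: "\<Delta> = \<kappa>\<^sup>2 * ((b - s)\<^sup>2 + (1 - \<kappa>\<^sup>2) * (p\<^sup>2 - s\<^sup>2))"
    by (simp add: \<Delta>_def B_def power2_eq_square algebra_simps)
  have \<Delta>0: "0 \<le> \<Delta>"
    unfolding \<Delta> using k2 sp2 by simp
  have "\<kappa>\<^sup>2 * s \<le> \<kappa>\<^sup>2 * p" using sp k2 by simp
  also have "\<dots> \<le> \<kappa> * p" using k2 p0 by (simp add: mult_right_mono)
  finally have B0: "0 \<le> B" using b0 by (simp add: B_def)
  have "(\<kappa> * p)\<^sup>2 \<le> b\<^sup>2"
    using b0 \<kappa> p0 by (intro power_mono) auto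
  then have "\<Delta> \<le> B\<^sup>2"
    using k2 by (simp add: \<Delta>_def power_mult_distrib)
  then have "sqrt \<Delta> \<le> B"
    using B0 by (simp add: real_le_lsqrt)
  then show r0: "0 \<le> oval_radius \<kappa> P b x"
    unfolding r_eq r_def using k2 by simp
  have "(\<kappa>\<^sup>2 * (b - s))\<^sup>2 \<le> \<Delta>"
  proof -
    have "(\<kappa>\<^sup>2 * (b - s))\<^sup>2 = \<kappa>\<^sup>2 * (\<kappa>\<^sup>2 * (b - s)\<^sup>2)"
      by (simp add: power2_eq_square algebra_simps)
    also have "\<dots> \<le> \<kappa>\<^sup>2 * (1 * (b - s)\<^sup>2)"
      using k2 by (intro mult_left_mono mult_right_mono) auto
    also have "\<dots> \<le> \<Delta>"
      unfolding \<Delta> using k2 sp2 by (intro mult_left_mono) auto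
    finally show ?thesis .
  qed
  then have "\<kappa>\<^sup>2 * (b - s) \<le> sqrt \<Delta>"
    by (rule real_le_rsqrt)
  then have "B - sqrt \<Delta> \<le> b * (1 - \<kappa>\<^sup>2)"
    by (simp add: B_def algebra_simps)
  then have rb: "r \<le> b"
    using k2 by (simp add: r_def divide_le_eq)
  have "(1 - \<kappa>\<^sup>2) * r = B - sqrt \<Delta>"
    using k2 by (simp add: r_def)
  then have "((1 - \<kappa>\<^sup>2) * r - B)\<^sup>2 = \<Delta>"
    using \<Delta>0 by simp
  then have "(1 - \<kappa>\<^sup>2) * ((1 - \<kappa>\<^sup>2) * r\<^sup>2 - 2 * B * r + (b\<^sup>2 - \<kappa>\<^sup>2 * p\<^sup>2)) = 0"
    by (simp add: \<Delta>_def power2_eq_square algebra_simps)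
  then have quad: "(1 - \<kappa>\<^sup>2) * r\<^sup>2 - 2 * B * r + (b\<^sup>2 - \<kappa>\<^sup>2 * p\<^sup>2) = 0"
    using k2 by simp
  have "(norm (r *\<^sub>R x - P))\<^sup>2 = r\<^sup>2 - 2 * r * s + p\<^sup>2"
  proof -
    have "(norm (r *\<^sub>R x - P))\<^sup>2 = (r *\<^sub>R x - P) \<bullet> (r *\<^sub>R x - P)"
      by (simp add: power2_norm_eq_inner)
    also have "\<dots> = r\<^sup>2 * (x \<bullet> x) - 2 * r * s + P \<bullet> P"
      by (simp add: inner_diff s_def inner_commute power2_eq_square)
    finally show ?thesis
      using x by (simp add: p_def flip: power2_norm_eq_inner)
  qed
  then have "(\<kappa> * norm (r *\<^sub>R x - P))\<^sup>2 = \<kappa>\<^sup>2 * (r\<^sup>2 - 2 * r * s + p\<^sup>2)"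
    by (simp add: power_mult_distrib)
  also have "\<dots> = (b - r)\<^sup>2"
    using quad by (simp add: B_def power2_eq_square algebra_simps)
  finally have "(\<kappa> * norm (r *\<^sub>R x - P))\<^sup>2 = (b - r)\<^sup>2" .
  then have "\<kappa> * norm (r *\<^sub>R x - P) = b - r"
    using rb \<kappa> by (subst (asm) power2_eq_iff_nonneg) auto
  then show "optical_path \<kappa> (oval_radius \<kappa> P b x *\<^sub>R x) P = b"
    using r0 x by (simp add: optical_path_def r_eq)
qed

lemma le_oval_radius_iff:
  fixes x P :: "real ^ 'n"
  assumes "norm x = 1" "0 < \<kappa>" "\<kappa> < 1" "\<kappa> * norm P \<le> b" "0 \<le> t"
  shows "t \<le> oval_radius \<kappa> P b x \<longleftrightarrow> optical_path \<kappa> (t *\<^sub>R x) P \<le> b"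
    and "oval_radius \<kappa> P b x \<le> t \<longleftrightarrow> b \<le> optical_path \<kappa> (t *\<^sub>R x) P"
  using oval_radius_solves[OF assms(1-4)] assms
    optical_path_ray_le_iff[of x \<kappa> t "oval_radius \<kappa> P b x" P] optical_path_ray_le_iff[of x \<kappa> "oval_radius \<kappa> P b x" t P]
  by auto

lemma oval_radius_bounds:
  fixes x P :: "real ^ 'n"
  assumes "norm x = 1" "0 < \<kappa>" "\<kappa> < 1" "\<kappa> * norm P \<le> b"
  shows "(1 - \<kappa>) * oval_radius \<kappa> P b x \<le> b - \<kappa> * norm P"
    and "b - \<kappa> * norm P \<le> (1 + \<kappa>) * oval_radius \<kappa> P b x"
  using oval_radius_solves[OF assms] assms 
    optical_path_bounds(1)[of \<kappa> P "oval_radius \<kappa> P b x *\<^sub>R x"] optical_path_bounds(2)[of \<kappa> "oval_radius \<kappa> P b x *\<^sub>R x" P]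
  by (auto simp: algebra_simps)

lemma oval_radius_mono:
  fixes x P :: "real ^ 'n"
  assumes "norm x = 1" "0 < \<kappa>" "\<kappa> < 1" "\<kappa> * norm P \<le> b" "b \<le> b'"
  shows "oval_radius \<kappa> P b x \<le> oval_radius \<kappa> P b' x"
  using assms oval_radius_solves[of x \<kappa> P b] by (subst le_oval_radius_iff) auto

lemma continuous_on_oval_radius [continuous_intros]:
  fixes P :: "real ^ 'n"
  assumes "continuous_on A g"
  shows "continuous_on A (\<lambda>x. oval_radius \<kappa> P b (g x))"
  unfolding oval_radius_def divide_inverse by (intro continuous_intros assms) 

section \<open>Points with several supporting hyperplanes\<close>

text \<open>
  The covector \<open>x - \<kappa> d\<close> is normal to the interface that refracts the direction \<open>x\<close>
  into \<open>d\<close>. Up to positive factors it determines \<open>d\<close>: the ray from the point \<open>x /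
  \<kappa>\<close>, which is outside the unit sphere, in the direction \<open>d - x / \<kappa>\<close> meets the
  sphere at most twice, and the condition \<open>x \<bullet> d \<ge> \<kappa>\<close>, which holds for refracted
  directions, selects the nearer point.
\<close>

lemma snell_unique:
  fixes x d d' :: "'a::real_inner"
  assumes \<kappa>: "0 < \<kappa>" "\<kappa> < 1" and n: "norm x = 1" "norm d = 1" "norm d' = 1"
    and vis: "\<kappa> \<le> x \<bullet> d" "\<kappa> \<le> x \<bullet> d'"
    and c: "0 < c" and eq: "x - \<kappa> *\<^sub>R d = c *\<^sub>R (x - \<kappa> *\<^sub>R d')"
  shows "d = d'"
proof -
  have k2: "0 < 1 - \<kappa>\<^sup>2" using \<kappa> by (simp add: abs_square_less_1)
  have step: "1 \<le> c" if n: "norm x = 1" "norm d = 1" "norm d' = 1"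
    and vis: "\<kappa> \<le> x \<bullet> d'" and c: "0 < c" and eq: "x - \<kappa> *\<^sub>R d = c *\<^sub>R (x - \<kappa> *\<^sub>R d')" for d d' c
  proof -
    have "\<kappa> *\<^sub>R d = (1 - c) *\<^sub>R x + (c * \<kappa>) *\<^sub>R d'"
      using eq by (simp add: algebra_simps)
    then have "(\<kappa> *\<^sub>R d) \<bullet> (\<kappa> *\<^sub>R d) = ((1 - c) *\<^sub>R x + (c * \<kappa>) *\<^sub>R d') \<bullet> ((1 - c) *\<^sub>R x + (c * \<kappa>) *\<^sub>R d')"
      by simp
    then have "\<kappa>\<^sup>2 = (1 - c)\<^sup>2 + 2 * (1 - c) * c * \<kappa> * (x \<bullet> d') + c\<^sup>2 * \<kappa>\<^sup>2"
      using n by (simp add: inner_add inner_commute norm_eq_1 power2_eq_square algebra_simps)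
    then have "(1 - c) * ((1 - c) + 2 * c * (\<kappa> * (x \<bullet> d')) - \<kappa>\<^sup>2 * (1 + c)) = 0"
      by (simp add: power2_eq_square algebra_simps)
    then consider "c = 1" | "(1 - c) + 2 * c * (\<kappa> * (x \<bullet> d')) = \<kappa>\<^sup>2 * (1 + c)"
      by auto
    then show ?thesis
    proof cases
      case 2
      have "2 * c * (\<kappa> * \<kappa>) \<le> 2 * c * (\<kappa> * (x \<bullet> d'))"
        using vis c \<kappa> by (intro mult_left_mono) auto
      with 2 have "(1 - c) * (1 - \<kappa>\<^sup>2) \<le> 0"
        by (simp add: power2_eq_square algebra_simps)
      with k2 show ?thesis
        by (simp add: mult_le_0_iff)
    qed simp
  qed
  have "x - \<kappa> *\<^sub>R d' = (1 / c) *\<^sub>R (x - \<kappa> *\<^sub>R d)"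
    using eq c by simp
  then have "1 \<le> 1 / c"
    using step[of d' d "1 / c"] n vis c by simp
  moreover have "1 \<le> c" using step[of d d' c] n vis c eq by simp
  ultimately have "c = 1" using c by (simp add: divide_simps split: if_splits)
  with eq \<kappa> show ?thesis by simp
qed

text \<open>
  For a monotone map \<open>T\<close> the resolvent \<open>z + w \<mapsto> z\<close> with \<open>w \<in> T z\<close>
  is a \<open>1\<close>-Lipschitz function. If \<open>T z\<close> has two elements, it contains a segment along which
  some coordinate of \<open>z + w\<close> varies, hence takes a rational value. So the resolvent maps part of a
  countable union of hyperplanes onto a set containing every such \<open>z\<close>, and Lipschitz maps preserve
  negligible sets.
\<close>

lemma negligible_multivalued_monotone:
  fixes T :: "'a::euclidean_space \<Rightarrow> 'a set"
  assumes mono: "\<And>z z' w w'. \<lbrakk>w \<in> T z; w' \<in> T z'\<rbrakk> \<Longrightarrow> 0 \<le> (w - w') \<bullet> (z - z')"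
    and conv: "\<And>z. convex (T z)"
  shows "negligible {z. \<exists>w\<in>T z. \<exists>w'\<in>T z. w \<noteq> w'}"
proof -
  define U where "U i q = {u. \<exists>z. u - z \<in> T z \<and> u \<bullet> i = q}" for i and q :: real
  define pr where "pr u = (SOME z. u - z \<in> T z)" for u
  have lip: "norm (z - z') \<le> norm (u - u')" if "u - z \<in> T z" "u' - z' \<in> T z'" for u z u' z'
  proof -
    have "0 \<le> (u - z - (u' - z')) \<bullet> (z - z')"
      using mono[OF that] .
    then have "norm (z - z') ^ 2 \<le> (u - u') \<bullet> (z - z')"
      by (simp add: power2_norm_eq_inner algebra_simps)
    also have "\<dots> \<le> norm (u - u') * norm (z - z')"
      by (rule norm_cauchy_schwarz)
    finally show ?thesis
      by (auto simp: power2_eq_square mult_le_cancel_right)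
  qed
  have pr: "pr u = z" if "u - z \<in> T z" for u z
  proof -
    have "u - pr u \<in> T (pr u)" unfolding pr_def using that by (rule someI)
    from lip[OF this that] show ?thesis by simp
  qed
  have neg: "negligible (pr ` U i q)" if "i \<in> Basis" for i q
  proof (rule negligible_locally_Lipschitz_image)
    show "negligible (U i q)"
      using negligible_standard_hyperplane[OF that, of q]
      by (rule negligible_subset) (auto simp: U_def)
    show "\<exists>T B. open T \<and> x \<in> T \<and> (\<forall>y\<in>U i q \<inter> T. norm (pr y - pr x) \<le> B * norm (y - x))"
      if "x \<in> U i q" for x
    proof (intro exI conjI ballI)
      fix y assume "y \<in> U i q \<inter> UNIV"
      with that obtain z z' where "x - z \<in> T z" "y - z' \<in> T z'" by (auto simp: U_def)
      then show "norm (pr y - pr x) \<le> 1 * norm (y - x)"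
        using pr lip by simp
    qed auto
  qed simp
  have "negligible (\<Union>(i, q)\<in>Basis \<times> \<rat>. pr ` U i q)"
    by (rule negligible_countable_Union)
      (auto intro!: countable_image countable_SIGMA countable_rat neg uncountable_infinite
        simp: countable_finite)
  then show ?thesis
  proof (rule negligible_subset, intro subsetI)
    fix z assume "z \<in> {z. \<exists>w\<in>T z. \<exists>w'\<in>T z. w \<noteq> w'}"
    then obtain w w' where w: "w \<in> T z" "w' \<in> T z" "w \<noteq> w'" by blast
    then obtain i where i: "i \<in> Basis" "w \<bullet> i \<noteq> w' \<bullet> i"
      using euclidean_eq_iff by blast
    obtain a c where ac: "a \<in> T z" "c \<in> T z" "a \<bullet> i < c \<bullet> i"
      using w i by (metis linorder_neqE_linordered_idom)
    then obtain q where q: "q \<in> \<rat>" "a \<bullet> i + z \<bullet> i < q" "q < c \<bullet> i + z \<bullet> i"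
      using Rats_dense_in_real[of "a \<bullet> i + z \<bullet> i" "c \<bullet> i + z \<bullet> i"] by auto
    define t where "t = (q - z \<bullet> i - a \<bullet> i) / (c \<bullet> i - a \<bullet> i)"
    have t: "0 \<le> t" "t \<le> 1" "t * (c \<bullet> i - a \<bullet> i) = q - z \<bullet> i - a \<bullet> i"
      using q ac by (auto simp: t_def divide_simps)
    define v where "v = (1 - t) *\<^sub>R a + t *\<^sub>R c"
    have "v \<in> T z"
      unfolding v_def using conv ac t by (intro convexD) auto
    moreover have "(z + v) \<bullet> i = q"
      using t(3) by (simp add: v_def inner_add_left algebra_simps)
    ultimately have "z + v \<in> U i q" "pr (z + v) = z"
      by (auto simp: U_def intro!: exI[of _ z] pr)
    then have "z \<in> pr ` U i q"
      by (metis image_eqI)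
    then show "z \<in> (\<Union>(i, q)\<in>Basis \<times> \<rat>. pr ` U i q)"
      using i q by blast
  qed
qed

section \<open>Refractors in terms of active targets\<close>

text \<open>
  Support by some oval with focus \<open>P\<close>, with the level eliminated: the level can only be the optical path
  at the point of contact.
\<close>

definition active :: "real \<Rightarrow> (real ^ 'n) set \<Rightarrow> (real ^ 'n \<Rightarrow> real) \<Rightarrow> real ^ 'n \<Rightarrow> real ^ 'n \<Rightarrow> bool" where
  "active \<kappa> E \<rho> y P \<longleftrightarrow> (\<forall>x\<in>E. optical_path \<kappa> (\<rho> x *\<^sub>R x) P \<le> optical_path \<kappa> (\<rho> y *\<^sub>R y) P)"

text \<open>
  A sum of two norms is convex; at \<open>X\<close> the unit vectors \<open>sgn X\<close> and \<open>sgn (X -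
  P)\<close> are subgradients of the two terms.
\<close>

lemma optical_path_subgradient:
  fixes X X' P :: "'a::real_inner"
  assumes "0 \<le> \<kappa>"
  shows "optical_path \<kappa> X P + (sgn X + \<kappa> *\<^sub>R sgn (X - P)) \<bullet> (X' - X) \<le> optical_path \<kappa> X' P"
proof -
  have sub: "norm Y + sgn Y \<bullet> (Y' - Y) \<le> norm Y'" for Y Y' :: 'a
  proof (cases "Y = 0")
    case False
    have "norm Y + sgn Y \<bullet> (Y' - Y) = sgn Y \<bullet> Y'"
      using False by (simp add: inner_diff_right sgn_div_norm power2_norm_eq_inner[symmetric] power2_eq_square)
    also have "\<dots> \<le> norm (sgn Y) * norm Y'"
      by (rule norm_cauchy_schwarz)
    finally show ?thesis using False by (simp add: norm_sgn)
  qed simp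
  have "\<kappa> * (norm (X - P) + sgn (X - P) \<bullet> (X' - X)) \<le> \<kappa> * norm (X' - P)"
    using sub[of "X - P" "X' - P"] assms by (intro mult_left_mono) auto
  with sub[of X X'] show ?thesis
    by (simp add: optical_path_def inner_add_left algebra_simps)
qed

lemma active_limit:
  assumes act: "\<And>n. active \<kappa> E (R n) (y n) (P n)"
    and R: "\<And>x. x \<in> E \<Longrightarrow> (\<lambda>n. R n x) \<longlonglongrightarrow> \<rho> x"
    and y: "(\<lambda>n. R n (y n)) \<longlonglongrightarrow> \<rho> y0" "y \<longlonglongrightarrow> y0" and P: "P \<longlonglongrightarrow> P0"
  shows "active \<kappa> E \<rho> y0 P0"
  unfolding active_def
proof
  fix x assume x: "x \<in> E"
  show "optical_path \<kappa> (\<rho> x *\<^sub>R x) P0 \<le> optical_path \<kappa> (\<rho> y0 *\<^sub>R y0) P0"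
  proof (rule LIMSEQ_le)
    show "(\<lambda>n. optical_path \<kappa> (R n x *\<^sub>R x) (P n)) \<longlonglongrightarrow> optical_path \<kappa> (\<rho> x *\<^sub>R x) P0"
      unfolding optical_path_def by (intro tendsto_intros R x P)
    show "(\<lambda>n. optical_path \<kappa> (R n (y n) *\<^sub>R y n) (P n)) \<longlonglongrightarrow> optical_path \<kappa> (\<rho> y0 *\<^sub>R y0) P0"
      unfolding optical_path_def by (intro tendsto_intros y P)
    show "\<exists>N. \<forall>n\<ge>N. optical_path \<kappa> (R n x *\<^sub>R x) (P n) \<le> optical_path \<kappa> (R n (y n) *\<^sub>R y n) (P n)"
      using act x by (auto simp: active_def)
  qed
qed

text \<open>
  The geometric hypotheses, with \<open>E\<close> for the closed set of directions and \<open>K\<close> for the closed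
  set of targets. The bound on \<open>r\<^sub>0\<close> by the distance of the targets is stated for each target
  separately.
\<close>

locale near_field =
  fixes \<kappa> \<tau> r\<^sub>0 :: real and E K :: "(real ^ 'n) set"
  assumes kappa: "0 < \<kappa>" "\<kappa> < 1"
    and E: "compact E" "E \<subseteq> sphere 0 1"
    and K: "compact K"
    and tau: "0 < \<tau>" "\<tau> < 1 - \<kappa>"
    and cone: "\<And>x P. x \<in> E \<Longrightarrow> P \<in> K \<Longrightarrow> (\<kappa> + \<tau>) * norm P \<le> x \<bullet> P"
    and r0: "0 < r\<^sub>0" "\<And>P. P \<in> K \<Longrightarrow> (1 + \<kappa>) * r\<^sub>0 \<le> \<tau> * norm P"
    and visible: "\<And>x r m t t'. \<lbrakk>x \<in> E; 0 < r; r \<le> r\<^sub>0; norm m = 1; 0 \<le> t; 0 \<le> t';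
        r *\<^sub>R x + t *\<^sub>R m \<in> K; r *\<^sub>R x + t' *\<^sub>R m \<in> K\<rbrakk> \<Longrightarrow> r *\<^sub>R x + t *\<^sub>R m = r *\<^sub>R x + t' *\<^sub>R m"
begin

lemma norm_E [simp]: "x \<in> E \<Longrightarrow> norm x = 1"
  using E by auto

text \<open>
  The choice of \<open>r\<^sub>0\<close> is made for this: an oval through a point of radius at most
  \<open>r\<^sub>0\<close> has a level \<open>b \<le> (\<kappa> + \<tau>) |P| \<le> x \<bullet> P\<close>, so it is
  defined in all directions of \<open>E\<close>.
\<close>

lemma optical_path_below_cone:
  assumes "x \<in> E" "P \<in> K" "0 < r" "r \<le> r\<^sub>0"
  shows "\<kappa> * norm P < optical_path \<kappa> (r *\<^sub>R x) P" "optical_path \<kappa> (r *\<^sub>R x) P \<le> (\<kappa> + \<tau>) * norm P"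
    "(\<kappa> + \<tau>) * norm P < norm P" "r < norm P"
proof -
  show "\<kappa> * norm P < optical_path \<kappa> (r *\<^sub>R x) P"
    using optical_path_bounds(1)[of \<kappa> P "r *\<^sub>R x"] assms kappa
    by (smt (verit) abs_of_pos mult_pos_pos norm_E norm_scaleR mult.right_neutral)
  have "(1 + \<kappa>) * r \<le> (1 + \<kappa>) * r\<^sub>0"
    using assms kappa by (intro mult_left_mono) auto
  with r0(2)[OF assms(2)] have *: "(1 + \<kappa>) * r \<le> \<tau> * norm P" by simp
  then show "optical_path \<kappa> (r *\<^sub>R x) P \<le> (\<kappa> + \<tau>) * norm P"
    using optical_path_bounds(2)[of \<kappa> "r *\<^sub>R x" P] assms kappa by (simp add: algebra_simps)
  have "0 < (1 + \<kappa>) * r" using assms kappa by simp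
  with * have "0 < \<tau> * norm P" by simp
  then have "P \<noteq> 0" by auto
  then show "(\<kappa> + \<tau>) * norm P < norm P" using tau by simp
  have "r \<le> (1 + \<kappa>) * r" using assms kappa by simp
  also note *
  also have "\<tau> * norm P < 1 * norm P"
    using \<open>P \<noteq> 0\<close> tau kappa by (intro mult_strict_right_mono) auto
  finally show "r < norm P" by simp
qed

lemma ex_oval_supports_iff_active:
  assumes \<Omega>: "closure \<Omega> = E" and \<rho>: "\<And>x. x \<in> E \<Longrightarrow> 0 < \<rho> x \<and> \<rho> x \<le> r\<^sub>0"
    and y: "y \<in> E" and P: "P \<in> K"
  shows "(\<exists>b. oval_supports \<kappa> \<Omega> P b \<rho> y) \<longleftrightarrow> active \<kappa> E \<rho> y P"
proof
  assume "\<exists>b. oval_supports \<kappa> \<Omega> P b \<rho> y"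
  then obtain b where b: "\<kappa> * norm P < b" "\<rho> y = oval_radius \<kappa> P b y"
    "\<And>x. x \<in> E \<Longrightarrow> \<rho> x \<le> oval_radius \<kappa> P b x"
    by (auto simp: oval_supports_def \<Omega>)
  have "optical_path \<kappa> (\<rho> y *\<^sub>R y) P = b"
    using oval_radius_solves(2)[of y \<kappa> P b] kappa y b by simp
  moreover have "optical_path \<kappa> (\<rho> x *\<^sub>R x) P \<le> b" if "x \<in> E" for x
    using le_oval_radius_iff(1)[of x \<kappa> P b "\<rho> x"] b(1) b(3)[OF that] \<rho>[OF that] kappa that by auto
  ultimately show "active \<kappa> E \<rho> y P" by (simp add: active_def)
next
  assume act: "active \<kappa> E \<rho> y P"
  define b where "b = optical_path \<kappa> (\<rho> y *\<^sub>R y) P"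
  have b: "\<kappa> * norm P < b" "b \<le> (\<kappa> + \<tau>) * norm P" "b < norm P"
    using optical_path_below_cone[OF y P, of "\<rho> y"] \<rho>[OF y] by (auto simp: b_def)
  have "\<rho> x \<le> oval_radius \<kappa> P b x" if "x \<in> E" for x
    using le_oval_radius_iff(1)[of x \<kappa> P b "\<rho> x"] b(1) \<rho>[OF that] kappa that act
    by (auto simp: active_def b_def)
  moreover have "oval_radius \<kappa> P b y \<le> \<rho> y"
    using le_oval_radius_iff(2)[of y \<kappa> P b "\<rho> y"] b(1) \<rho>[OF y] kappa y by (auto simp: b_def)
  moreover have "b \<le> x \<bullet> P" if "x \<in> E" for x
    using cone[OF that P] b by simp
  ultimately have "oval_supports \<kappa> \<Omega> P b \<rho> y"
    using b y by (auto simp: oval_supports_def \<Omega> intro: order_antisym)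
  then show "\<exists>b. oval_supports \<kappa> \<Omega> P b \<rho> y" ..
qed

text \<open>
  The bound \<open>\<rho> \<le> r\<^sub>0\<close> is left out, so that envelopes of ovals with arbitrarily high levels
  are included.
\<close>

definition refractor :: "(real ^ 'n \<Rightarrow> real) \<Rightarrow> bool" where
  "refractor \<rho> \<longleftrightarrow> (\<forall>y\<in>E. 0 < \<rho> y \<and> (\<exists>P\<in>K. active \<kappa> E \<rho> y P))"

text \<open>
  The surface lies inside an oval that touches it at \<open>y\<close>, and the radii of an oval are comparable.
\<close>

lemma refractor_harnack:
  assumes "refractor \<rho>" "x \<in> E" "y \<in> E"
  shows "(1 - \<kappa>) * \<rho> x \<le> (1 + \<kappa>) * \<rho> y"
proof -
  obtain P where P: "P \<in> K" "active \<kappa> E \<rho> y P" "0 < \<rho> x" "0 < \<rho> y"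
    using assms by (auto simp: refractor_def)
  have "optical_path \<kappa> (\<rho> x *\<^sub>R x) P \<le> optical_path \<kappa> (\<rho> y *\<^sub>R y) P"
    using P assms by (auto simp: active_def)
  then show ?thesis
    using optical_path_bounds(1)[of \<kappa> P "\<rho> x *\<^sub>R x"] optical_path_bounds(2)[of \<kappa> "\<rho> y *\<^sub>R y" P] kappa assms P
    by simp
qed

text \<open>
  Comparing optical paths to the target active at \<open>y\<close> gives \<open>\<rho> x - \<rho> y \<le> \<kappa>
  |\<rho> x x - \<rho> y y|\<close>. The radial part of the right-hand side is at most \<open>\<kappa> |\<rho> x -
  \<rho> y|\<close> and is absorbed on the left.
\<close>

lemma refractor_lipschitz:
  assumes "refractor \<rho>" "x \<in> E" "y \<in> E"
  shows "(1 - \<kappa>) * \<bar>\<rho> x - \<rho> y\<bar> \<le> \<kappa> * \<rho> y * norm (x - y)"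
proof -
  let ?X = "\<rho> x *\<^sub>R x" and ?Y = "\<rho> y *\<^sub>R y"
  have pos: "0 < \<rho> x" "0 < \<rho> y" using assms by (auto simp: refractor_def)
  have *: "\<rho> x - \<rho> y \<le> \<kappa> * norm (\<rho> x *\<^sub>R x - \<rho> y *\<^sub>R y)" if xy: "x \<in> E" "y \<in> E" for x y
  proof -
    obtain P where "active \<kappa> E \<rho> y P" "0 < \<rho> x" "0 < \<rho> y"
      using assms(1) xy by (auto simp: refractor_def)
    then have "\<rho> x - \<rho> y \<le> \<kappa> * (norm (\<rho> y *\<^sub>R y - P) - norm (\<rho> x *\<^sub>R x - P))"
      using xy by (auto simp: active_def optical_path_def algebra_simps)
    also have "\<dots> \<le> \<kappa> * norm ((\<rho> y *\<^sub>R y - P) - (\<rho> x *\<^sub>R x - P))"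
      using kappa by (intro mult_left_mono norm_triangle_ineq2) auto
    also have "(\<rho> y *\<^sub>R y - P) - (\<rho> x *\<^sub>R x - P) = - (\<rho> x *\<^sub>R x - \<rho> y *\<^sub>R y)"
      by simp
    finally show ?thesis
      by (simp only: norm_minus_cancel)
  qed
  have "\<bar>\<rho> x - \<rho> y\<bar> \<le> \<kappa> * norm (?X - ?Y)"
    using *[OF assms(2,3)] *[OF assms(3,2)] by (auto simp: norm_minus_commute)
  also have "?X - ?Y = (\<rho> x - \<rho> y) *\<^sub>R x + \<rho> y *\<^sub>R (x - y)"
    by (simp add: algebra_simps)
  also have "\<kappa> * norm \<dots> \<le> \<kappa> * (\<bar>\<rho> x - \<rho> y\<bar> + \<rho> y * norm (x - y))"
    using kappa pos assms norm_triangle_ineq[of "(\<rho> x - \<rho> y) *\<^sub>R x" "\<rho> y *\<^sub>R (x - y)"]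
    by (intro mult_left_mono) auto
  finally show ?thesis by (simp add: algebra_simps)
qed

lemma refractor_continuous:
  assumes "refractor \<rho>" shows "continuous_on E \<rho>"
proof (unfold continuous_on_def, intro ballI)
  fix y assume y: "y \<in> E"
  have "\<bar>\<rho> x - \<rho> y\<bar> \<le> \<kappa> * \<rho> y / (1 - \<kappa>) * norm (x - y)" if "x \<in> E" for x
    using refractor_lipschitz[OF assms that y] kappa by (simp add: field_simps)
  then have ev: "\<forall>\<^sub>F x in at y within E. norm (\<rho> x - \<rho> y) \<le> \<kappa> * \<rho> y / (1 - \<kappa>) * norm (x - y)"
    unfolding eventually_at_filter real_norm_def by (intro always_eventually) blast
  have "((\<lambda>x. \<kappa> * \<rho> y / (1 - \<kappa>) * norm (x - y)) \<longlongrightarrow> \<kappa> * \<rho> y / (1 - \<kappa>) * norm (y - y)) (at y within E)"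
    by (intro tendsto_mult tendsto_const tendsto_norm tendsto_diff tendsto_ident_at)
  then have "((\<lambda>x. \<kappa> * \<rho> y / (1 - \<kappa>) * norm (x - y)) \<longlongrightarrow> 0) (at y within E)"
    by simp
  from Lim_null_comparison[OF ev this] have "((\<lambda>x. \<rho> x - \<rho> y) \<longlongrightarrow> 0) (at y within E)" .
  then show "(\<rho> \<longlongrightarrow> \<rho> y) (at y within E)"
    by (simp add: LIM_zero_iff)
qed

text \<open>
  Restricted to radii at most \<open>r\<^sub>0\<close>, because only there does visibility separate the targets.
\<close>

definition multi_active :: "(real ^ 'n \<Rightarrow> real) \<Rightarrow> (real ^ 'n) set" where
  "multi_active \<rho> = {x \<in> E. \<rho> x \<le> r\<^sub>0 \<and>
     (\<exists>P\<in>K. \<exists>P'\<in>K. P \<noteq> P' \<and> active \<kappa> E \<rho> x P \<and> active \<kappa> E \<rho> x P')}"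

text \<open>
  The covector \<open>x - \<kappa> d\<close> is the subgradient of the optical path at the point of contact, and the
  direction \<open>d\<close> towards the target satisfies the condition \<open>x \<bullet> d \<ge> \<kappa>\<close> of
  \<open>snell_unique\<close>, because the level is at most \<open>x \<bullet> P\<close>.
\<close>

lemma active_normal:
  assumes x: "x \<in> E" and P: "P \<in> K" and \<rho>: "0 < \<rho> x" "\<rho> x \<le> r\<^sub>0"
    and act: "active \<kappa> E \<rho> x P"
  defines "d \<equiv> sgn (P - \<rho> x *\<^sub>R x)"
  shows "norm d = 1" "\<kappa> \<le> x \<bullet> d" "0 < (x - \<kappa> *\<^sub>R d) \<bullet> x"
    "P = \<rho> x *\<^sub>R x + norm (P - \<rho> x *\<^sub>R x) *\<^sub>R d"
    "\<And>y. y \<in> E \<Longrightarrow> (x - \<kappa> *\<^sub>R d) \<bullet> (\<rho> y *\<^sub>R y) \<le> (x - \<kappa> *\<^sub>R d) \<bullet> (\<rho> x *\<^sub>R x)"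
proof -
  have ne: "P - \<rho> x *\<^sub>R x \<noteq> 0"
    using optical_path_below_cone(4)[OF x P \<rho>] x \<rho> by auto
  then show n: "norm d = 1" by (simp add: d_def norm_sgn)
  show "P = \<rho> x *\<^sub>R x + norm (P - \<rho> x *\<^sub>R x) *\<^sub>R d"
    using ne by (simp add: d_def sgn_div_norm)
  have "\<rho> x + \<kappa> * norm (P - \<rho> x *\<^sub>R x) \<le> x \<bullet> P"
    using optical_path_below_cone(2)[OF x P \<rho>] cone[OF x P] x \<rho> by (simp add: optical_path_def norm_minus_commute)
  then have "\<kappa> * norm (P - \<rho> x *\<^sub>R x) \<le> x \<bullet> (P - \<rho> x *\<^sub>R x)"
    using norm_E[OF x] by (simp add: inner_diff_right norm_eq_1)
  moreover have "x \<bullet> d = (x \<bullet> (P - \<rho> x *\<^sub>R x)) / norm (P - \<rho> x *\<^sub>R x)"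
    unfolding d_def sgn_div_norm inner_scaleR_right by (simp add: divide_inverse)
  ultimately show "\<kappa> \<le> x \<bullet> d"
    using ne by (simp add: pos_le_divide_eq)
  have "d \<bullet> x \<le> 1"
    using norm_cauchy_schwarz[of d x] n x by simp
  then have "\<kappa> * (d \<bullet> x) < 1"
    using mult_left_mono[of "d \<bullet> x" 1 \<kappa>] kappa by linarith
  then show "0 < (x - \<kappa> *\<^sub>R d) \<bullet> x"
    using kappa norm_E[OF x] by (simp add: inner_diff_left norm_eq_1)
  fix y assume y: "y \<in> E"
  have "sgn (\<rho> x *\<^sub>R x) = x"
    using \<rho> x by (simp add: sgn_div_norm)
  moreover have "sgn (\<rho> x *\<^sub>R x - P) = - d"
    by (simp add: d_def flip: sgn_minus)
  ultimately have "optical_path \<kappa> (\<rho> x *\<^sub>R x) P + (x - \<kappa> *\<^sub>R d) \<bullet> (\<rho> y *\<^sub>R y - \<rho> x *\<^sub>R x) \<le> optical_path \<kappa> (\<rho> y *\<^sub>R y) P"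
    using optical_path_subgradient[of \<kappa> "\<rho> x *\<^sub>R x" P "\<rho> y *\<^sub>R y"] kappa by simp
  moreover have "optical_path \<kappa> (\<rho> y *\<^sub>R y) P \<le> optical_path \<kappa> (\<rho> x *\<^sub>R x) P"
    using act y by (simp add: active_def)
  ultimately show "(x - \<kappa> *\<^sub>R d) \<bullet> (\<rho> y *\<^sub>R y) \<le> (x - \<kappa> *\<^sub>R d) \<bullet> (\<rho> x *\<^sub>R x)"
    by (simp add: inner_diff_right)
qed

text \<open>
  For \<open>z\<close> on the ray through a point \<open>X\<close> of the surface let \<open>T z\<close> consist of
  the covectors \<open>w\<close> with \<open>w \<bullet> X = 1\<close> that are at most \<open>1\<close> on the
  surface. They are subgradients of the gauge of the convex hull of the surface and the origin, so \<open>T\<close> is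
  monotone, and two active targets give two elements of \<open>T z\<close>.
\<close>

lemma negligible_cone_multi_active:
  assumes pos: "\<And>x. x \<in> E \<Longrightarrow> 0 < \<rho> x"
  shows "negligible {t *\<^sub>R x | t x. x \<in> multi_active \<rho> \<and> 0 < t \<and> t \<le> 1}"
proof -
  define T where "T z = {w. z \<noteq> 0 \<and> sgn z \<in> E \<and> w \<bullet> (\<rho> (sgn z) *\<^sub>R sgn z) = 1 \<and>
      (\<forall>x\<in>E. w \<bullet> (\<rho> x *\<^sub>R x) \<le> 1)}" for z
  have "negligible {z. \<exists>w\<in>T z. \<exists>w'\<in>T z. w \<noteq> w'}"
  proof (rule negligible_multivalued_monotone)
    fix z z' w w' assume w: "w \<in> T z" "w' \<in> T z'"
    define s where "s z = norm z / \<rho> (sgn z)" for z :: "real ^ 'n"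
    have s: "z = s z *\<^sub>R (\<rho> (sgn z) *\<^sub>R sgn z)" "0 \<le> s z" if "z \<noteq> 0" "sgn z \<in> E" for z
      using that pos[of "sgn z"] by (auto simp: s_def sgn_div_norm)
    have zz: "z \<noteq> 0" "sgn z \<in> E" "z' \<noteq> 0" "sgn z' \<in> E"
      using w by (auto simp: T_def)
    define X where "X = \<rho> (sgn z) *\<^sub>R sgn z"
    define X' where "X' = \<rho> (sgn z') *\<^sub>R sgn z'"
    have z: "z = s z *\<^sub>R X" "z' = s z' *\<^sub>R X'" and s0: "0 \<le> s z" "0 \<le> s z'"
      using s zz by (auto simp: X_def X'_def)
    have X: "w \<bullet> X = 1" "w' \<bullet> X' = 1" "w \<bullet> X' \<le> 1" "w' \<bullet> X \<le> 1"
      using w by (auto simp: T_def X_def X'_def)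
    have "(w - w') \<bullet> (z - z') = (w - w') \<bullet> (s z *\<^sub>R X - s z' *\<^sub>R X')"
      using z by simp
    also have "\<dots> = s z * (1 - w' \<bullet> X) + s z' * (1 - w \<bullet> X')"
      using X by (simp add: inner_diff_left inner_diff_right algebra_simps)
    also have "\<dots> \<ge> 0" using s0 X by simp
    finally show "0 \<le> (w - w') \<bullet> (z - z')" .
  next
    fix z :: "real ^ 'n"
    show "convex (T z)"
    proof (rule convexI)
      fix w w' and u v :: real
      assume w: "w \<in> T z" "w' \<in> T z" and uv: "0 \<le> u" "0 \<le> v" "u + v = 1"
      from w uv show "u *\<^sub>R w + v *\<^sub>R w' \<in> T z"
        unfolding T_def mem_Collect_eq inner_add_left inner_scaleR_left by (auto intro: convex_bound_le)
    qed
  qed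
  then show ?thesis
  proof (rule negligible_subset, intro subsetI)
    fix z assume "z \<in> {t *\<^sub>R x | t x. x \<in> multi_active \<rho> \<and> 0 < t \<and> t \<le> 1}"
    then obtain t x P P' where z: "z = t *\<^sub>R x" "0 < t" and x: "x \<in> E" "\<rho> x \<le> r\<^sub>0"
      and P: "P \<in> K" "P' \<in> K" "P \<noteq> P'" "active \<kappa> E \<rho> x P" "active \<kappa> E \<rho> x P'"
      by (auto simp: multi_active_def)
    have sz: "sgn z = x" "z \<noteq> 0"
      using z norm_E[OF x(1)] by (auto simp: sgn_div_norm)
    define X where "X = \<rho> x *\<^sub>R x"
    have \<rho>: "0 < \<rho> x" using pos x by simp
    define d where "d = sgn (P - X)"
    define d' where "d' = sgn (P' - X)"
    note n = active_normal[OF x(1) P(1) \<rho> x(2) P(4), folded X_def, folded d_def]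
    note n' = active_normal[OF x(1) P(2) \<rho> x(2) P(5), folded X_def, folded d'_def]
    define v where "v = x - \<kappa> *\<^sub>R d"
    define v' where "v' = x - \<kappa> *\<^sub>R d'"
    have vX: "0 < v \<bullet> X" "0 < v' \<bullet> X"
      using n(3) n'(3) \<rho> by (auto simp: v_def v'_def X_def)
    have inT: "(1 / (v \<bullet> X)) *\<^sub>R v \<in> T z" if "0 < v \<bullet> X" "\<And>y. y \<in> E \<Longrightarrow> v \<bullet> (\<rho> y *\<^sub>R y) \<le> v \<bullet> X" for v
      using that sz x by (auto simp: T_def X_def divide_le_eq)
    have T: "(1 / (v \<bullet> X)) *\<^sub>R v \<in> T z" "(1 / (v' \<bullet> X)) *\<^sub>R v' \<in> T z"
      using inT[OF vX(1)] inT[OF vX(2)] n(5) n'(5) by (auto simp: v_def v'_def)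
    have "(1 / (v \<bullet> X)) *\<^sub>R v \<noteq> (1 / (v' \<bullet> X)) *\<^sub>R v'"
    proof
      assume eq: "(1 / (v \<bullet> X)) *\<^sub>R v = (1 / (v' \<bullet> X)) *\<^sub>R v'"
      have "v = (v \<bullet> X) *\<^sub>R ((1 / (v \<bullet> X)) *\<^sub>R v)"
        using vX by simp
      also note eq
      finally have "v = ((v \<bullet> X) / (v' \<bullet> X)) *\<^sub>R v'"
        by simp
      then obtain c where "0 < c" "v = c *\<^sub>R v'"
        using vX by (metis divide_pos_pos)
      then have dd: "d = d'"
        using snell_unique[OF kappa norm_E[OF x(1)] n(1) n'(1) n(2) n'(2)] unfolding v_def v'_def by blast
      have "X + norm (P - X) *\<^sub>R d = X + norm (P' - X) *\<^sub>R d"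
        unfolding X_def
      proof (rule visible[OF x(1) \<rho> x(2) n(1)])
        show "\<rho> x *\<^sub>R x + norm (P - \<rho> x *\<^sub>R x) *\<^sub>R d \<in> K"
          using n(4) P(1) by (simp add: X_def)
        show "\<rho> x *\<^sub>R x + norm (P' - \<rho> x *\<^sub>R x) *\<^sub>R d \<in> K"
          using n'(4) P(2) by (simp add: X_def dd)
      qed auto
      then show False using n(4) n'(4) dd P(3) by simp
    qed
    with T show "z \<in> {z. \<exists>w\<in>T z. \<exists>w'\<in>T z. w \<noteq> w'}" by blast
  qed
qed

text \<open>
  Requiring the two active targets to be at distance at least \<open>1 / (k + 1)\<close> gives a closed set, by
  compactness of \<open>K\<close>.
\<close>

lemma multi_active_borel:
  assumes cont: "continuous_on E \<rho>"
  shows "multi_active \<rho> \<in> sets borel"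
proof -
  define B where "B k = {x \<in> E. \<rho> x \<le> r\<^sub>0 \<and>
     (\<exists>P\<in>K. \<exists>P'\<in>K. 1 / real (Suc k) \<le> dist P P' \<and> active \<kappa> E \<rho> x P \<and> active \<kappa> E \<rho> x P')}" for k
  have "closed (B k)" for k
  proof (unfold closed_sequential_limits, intro allI impI, elim conjE)
    fix y y0 assume y: "\<forall>n. y n \<in> B k" and lim: "y \<longlonglongrightarrow> y0"
    then have yE: "y n \<in> E" "\<rho> (y n) \<le> r\<^sub>0" for n by (auto simp: B_def)
    have "\<forall>n. \<exists>Q. Q \<in> K \<times> K \<and> 1 / real (Suc k) \<le> dist (fst Q) (snd Q) \<and>
        active \<kappa> E \<rho> (y n) (fst Q) \<and> active \<kappa> E \<rho> (y n) (snd Q)"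
      using y by (fastforce simp: B_def)
    then obtain Q where Q: "\<And>n. Q n \<in> K \<times> K" "\<And>n. 1 / real (Suc k) \<le> dist (fst (Q n)) (snd (Q n))"
        "\<And>n. active \<kappa> E \<rho> (y n) (fst (Q n))" "\<And>n. active \<kappa> E \<rho> (y n) (snd (Q n))"
      by metis
    have "seq_compact (K \<times> K)" using K by (simp add: compact_Times compact_imp_seq_compact)
    then obtain Q0 s where s: "Q0 \<in> K \<times> K" "strict_mono s" "(Q \<circ> s) \<longlonglongrightarrow> Q0"
      using Q(1) by (metis seq_compactE)
    have y0: "y0 \<in> E"
      using E(1) lim yE(1) compact_imp_closed closed_sequentially by metis
    have \<rho>lim: "(\<lambda>n. \<rho> (y n)) \<longlonglongrightarrow> \<rho> y0"
      using continuous_on_tendsto_compose[OF cont lim y0] yE by simp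
    have lims: "(\<lambda>n. y (s n)) \<longlonglongrightarrow> y0" "(\<lambda>n. \<rho> (y (s n))) \<longlonglongrightarrow> \<rho> y0"
      using LIMSEQ_subseq_LIMSEQ[OF lim s(2)] LIMSEQ_subseq_LIMSEQ[OF \<rho>lim s(2)] by (auto simp: o_def)
    have Ql: "(\<lambda>n. fst (Q (s n))) \<longlonglongrightarrow> fst Q0" "(\<lambda>n. snd (Q (s n))) \<longlonglongrightarrow> snd Q0"
      using s(3) by (auto simp: o_def intro: tendsto_fst tendsto_snd)
    have "active \<kappa> E \<rho> y0 (fst Q0)" "active \<kappa> E \<rho> y0 (snd Q0)"
      by (rule active_limit[where R = "\<lambda>_. \<rho>"]; (rule Q lims Ql tendsto_const))+
    moreover have "1 / real (Suc k) \<le> dist (fst Q0) (snd Q0)"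
      using Lim_bounded2[OF tendsto_dist[OF Ql], of 0] Q(2) by blast
    moreover have "\<rho> y0 \<le> r\<^sub>0"
      using Lim_bounded[OF \<rho>lim, of 0] yE by blast
    ultimately show "y0 \<in> B k"
      using s(1) y0 unfolding B_def
      by (intro CollectI conjI bexI[of _ "fst Q0"] bexI[of _ "snd Q0"]) (auto simp: mem_Times_iff)
  qed
  moreover have "multi_active \<rho> = (\<Union>k. B k)"
  proof (intro equalityI subsetI)
    fix x assume "x \<in> multi_active \<rho>"
    then obtain P P' where x: "x \<in> E" "\<rho> x \<le> r\<^sub>0" and P: "P \<in> K" "P' \<in> K" "P \<noteq> P'"
      "active \<kappa> E \<rho> x P" "active \<kappa> E \<rho> x P'"
      by (auto simp: multi_active_def)
    obtain k where "1 / real (Suc k) < dist P P'"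
      using P(3) nat_approx_posE[of "dist P P'"] by auto
    then have "x \<in> B k"
      unfolding B_def using x P by (intro CollectI conjI bexI[of _ P] bexI[of _ P']) auto
    then show "x \<in> (\<Union>k. B k)" by blast
  next
    fix x assume "x \<in> (\<Union>k. B k)"
    then obtain k P P' where x: "x \<in> E" "\<rho> x \<le> r\<^sub>0" and P: "P \<in> K" "P' \<in> K" "1 / real (Suc k) \<le> dist P P'"
      "active \<kappa> E \<rho> x P" "active \<kappa> E \<rho> x P'"
      by (auto simp: B_def)
    have "0 < 1 / real (Suc k)" by simp
    with P(3) have "P \<noteq> P'" by auto
    with x P show "x \<in> multi_active \<rho>" by (auto simp: multi_active_def)
  qed
  ultimately show ?thesis by auto
qed

end

section \<open>Prescribing masses by lowering levels\<close>

text \<open>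
  Here \<open>M i b\<close> is the mass that \<open>i\<close> receives for levels \<open>b\<close>; by
  \<open>mono\<close>, raising the levels of the others cannot decrease it. The admissible set \<open>W\<close> is
  closed under minima, hence contains its infimum. If some \<open>i\<close> received too little there, lowering
  \<open>b i\<close> slightly would stay in \<open>W\<close>: \<open>i\<close> stays below its bound by continuity,
  and the others only lose.
\<close>

lemma exists_levels_with_masses:
  fixes M :: "'i \<Rightarrow> ('i \<Rightarrow> real) \<Rightarrow> real" and l m :: "'i \<Rightarrow> real"
  assumes fin: "finite I"
    and mono: "\<And>i b b'. \<lbrakk>i \<in> I; \<And>j. j \<in> I \<Longrightarrow> l j \<le> b j \<and> b j \<le> b' j; b i = b' i\<rbrakk> \<Longrightarrow> M i b \<le> M i b'"
    and cont: "\<And>i b c. \<lbrakk>i \<in> I; \<And>n j. j \<in> I \<Longrightarrow> l j \<le> c n j; \<And>j. j \<in> I \<Longrightarrow> (\<lambda>n. c n j) \<longlonglongrightarrow> b j\<rbrakk>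
        \<Longrightarrow> (\<lambda>n. M i (c n)) \<longlonglongrightarrow> M i b"
    and W: "W = {b. \<forall>i\<in>I. l i \<le> b i \<and> M i b \<le> m i}"
    and ne: "W \<noteq> {}"
    and low: "\<And>b i. \<lbrakk>b \<in> W; i \<in> I\<rbrakk> \<Longrightarrow> l i < b i"
  obtains b where "\<And>i. i \<in> I \<Longrightarrow> l i < b i" "\<And>i. i \<in> I \<Longrightarrow> M i b = m i"
proof -
  define bs where "bs i = (INF b\<in>W. b i)" for i
  have bdd: "bdd_below ((\<lambda>b. b i) ` W)" if "i \<in> I" for i
    using that by (auto simp: W intro!: bdd_belowI[of _ "l i"])
  have bs_le: "bs i \<le> b i" if "b \<in> W" "i \<in> I" for b i
    unfolding bs_def using bdd that by (intro cINF_lower) auto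
  have min_W: "(\<lambda>i. min (b i) (b' i)) \<in> W" if "b \<in> W" "b' \<in> W" for b b'
  proof -
    have "M i (\<lambda>i. min (b i) (b' i)) \<le> m i" if i: "i \<in> I" for i
    proof (cases "b i \<le> b' i")
      case True
      have "M i (\<lambda>i. min (b i) (b' i)) \<le> M i b"
        using \<open>b \<in> W\<close> \<open>b' \<in> W\<close> True i by (intro mono) (auto simp: W)
      with \<open>b \<in> W\<close> i show ?thesis by (force simp: W)
    next
      case False
      have "M i (\<lambda>i. min (b i) (b' i)) \<le> M i b'"
        using \<open>b \<in> W\<close> \<open>b' \<in> W\<close> False i by (intro mono) (auto simp: W)
      with \<open>b' \<in> W\<close> i show ?thesis by (force simp: W)
    qed
    then show ?thesis using that by (auto simp: W)
  qed
  have approx: "\<exists>b\<in>W. \<forall>i\<in>J. b i < bs i + e" if "0 < e" "finite J" "J \<subseteq> I" for e J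
    using that(2,3)
  proof induction
    case empty
    with ne show ?case by auto
  next
    case (insert i J)
    then obtain b where b: "b \<in> W" "\<forall>i\<in>J. b i < bs i + e" by auto
    have "(INF b\<in>W. b i) < bs i + e" using that(1) by (simp add: bs_def)
    then obtain b' where b': "b' \<in> W" "b' i < bs i + e"
      using ne bdd[of i] insert.prems by (subst (asm) cINF_less_iff) auto
    show ?case
      using b b' by (intro bexI[OF _ min_W[OF b(1) b'(1)]]) auto
  qed
  have "\<forall>n. \<exists>b\<in>W. \<forall>i\<in>I. b i < bs i + 1 / real (Suc n)"
    using approx[OF _ fin order_refl] by simp
  then obtain c where c: "\<And>n. c n \<in> W" "\<And>n i. i \<in> I \<Longrightarrow> c n i < bs i + 1 / real (Suc n)"
    by metis
  have c_lim: "(\<lambda>n. c n i) \<longlonglongrightarrow> bs i" if "i \<in> I" for i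
  proof (rule tendsto_sandwich)
    show "(\<lambda>n. bs i) \<longlonglongrightarrow> bs i" by simp
    show "(\<lambda>n. bs i + 1 / real (Suc n)) \<longlonglongrightarrow> bs i"
      using tendsto_add[OF tendsto_const LIMSEQ_inverse_real_of_nat, of "bs i"] by (simp add: inverse_eq_divide)
    show "\<forall>\<^sub>F n in sequentially. bs i \<le> c n i"
      using bs_le c(1) that by auto
    show "\<forall>\<^sub>F n in sequentially. c n i \<le> bs i + 1 / real (Suc n)"
      using c(2)[OF that] less_imp_le by (intro always_eventually) blast
  qed
  have bs_W: "bs \<in> W"
  proof -
    have "l i \<le> bs i \<and> M i bs \<le> m i" if i: "i \<in> I" for i
    proof
      show "l i \<le> bs i"
        using c(1) i by (intro Lim_bounded2[OF c_lim[OF i], of 0]) (auto simp: W)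
      have "(\<lambda>n. M i (c n)) \<longlonglongrightarrow> M i bs"
        using i c(1) c_lim by (intro cont) (auto simp: W)
      then show "M i bs \<le> m i"
        using c(1) i by (intro Lim_bounded[of _ _ 0]) (auto simp: W)
    qed
    then show ?thesis by (simp add: W)
  qed
  have "M i bs = m i" if i: "i \<in> I" for i
  proof (rule ccontr)
    assume "M i bs \<noteq> m i"
    then have less: "M i bs < m i" using bs_W i by (force simp: W)
    define d where "d = bs i - l i"
    have d: "0 < d" using low[OF bs_W i] by (simp add: d_def)
    define a where "a n = bs(i := bs i - d / real (Suc n))" for n
    have a_l: "l j \<le> a n j" if "j \<in> I" for n j
    proof -
      have "d / real (Suc n) \<le> d / 1" using d by (intro divide_left_mono) auto
      then show ?thesis using that bs_W by (auto simp: a_def W d_def)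
    qed
    have a_le: "a n j \<le> bs j" for n j
      using d by (auto simp: a_def)
    have lim: "(\<lambda>n. M i (a n)) \<longlonglongrightarrow> M i bs"
    proof (rule cont[OF i a_l])
      show "(\<lambda>n. a n j) \<longlonglongrightarrow> bs j" for j
        using tendsto_diff[OF tendsto_const tendsto_mult_right_zero[OF LIMSEQ_inverse_real_of_nat], of "bs i" d]
        by (cases "j = i") (auto simp: a_def divide_inverse)
    qed
    obtain n where n: "M i (a n) < m i"
      using order_tendstoD(2)[OF lim less] unfolding eventually_sequentially by blast
    have "M j (a n) \<le> m j" if j: "j \<in> I" for j
    proof (cases "j = i")
      case False
      then have "M j (a n) \<le> M j bs"
        using j a_l a_le by (intro mono) (auto simp: a_def)
      with bs_W j show ?thesis by (force simp: W)
    qed (use n in simp)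
    then have "a n \<in> W" using a_l by (auto simp: W)
    then have "bs i \<le> a n i" using bs_le i by blast
    moreover have "0 < d / real (Suc n)" using d by simp
    ultimately show False by (simp add: a_def)
  qed
  with bs_W low show ?thesis using that by blast
qed

section \<open>Envelopes of finitely many ovals\<close>

definition envelope :: "real \<Rightarrow> (real ^ 'n) set \<Rightarrow> (real ^ 'n \<Rightarrow> real) \<Rightarrow> real ^ 'n \<Rightarrow> real" where
  "envelope \<kappa> I b x = (MIN P\<in>I. oval_radius \<kappa> P (b P) x)"

definition cell :: "real \<Rightarrow> (real ^ 'n) set \<Rightarrow> (real ^ 'n \<Rightarrow> real) \<Rightarrow> real ^ 'n \<Rightarrow> (real ^ 'n) set" where
  "cell \<kappa> I b P = {x. \<forall>Q\<in>I. oval_radius \<kappa> P (b P) x \<le> oval_radius \<kappa> Q (b Q) x}"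

lemma closed_cell: "closed (cell \<kappa> I b P)"
proof -
  have "cell \<kappa> I b P = (\<Inter>Q\<in>I. {x. oval_radius \<kappa> P (b P) x \<le> oval_radius \<kappa> Q (b Q) x})"
    by (auto simp: cell_def)
  also have "closed \<dots>"
    by (intro closed_INT ballI closed_Collect_le continuous_intros)
  finally show ?thesis .
qed

lemma mem_cell_iff:
  assumes "finite I" "P \<in> I"
  shows "x \<in> cell \<kappa> I b P \<longleftrightarrow> oval_radius \<kappa> P (b P) x = envelope \<kappa> I b x"
  unfolding cell_def envelope_def using assms
  by (auto intro!: Min_eqI[symmetric] antisym[OF Min.boundedI] simp: Min_le)

lemma ex_cell:
  assumes "finite I" "I \<noteq> {}" obtains P where "P \<in> I" "x \<in> cell \<kappa> I b P"
proof -
  have "envelope \<kappa> I b x \<in> (\<lambda>P. oval_radius \<kappa> P (b P) x) ` I"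
    unfolding envelope_def using assms by (intro Min_in) auto
  then obtain P where "P \<in> I" "envelope \<kappa> I b x = oval_radius \<kappa> P (b P) x" by blast
  with that[of P] mem_cell_iff[OF assms(1), of P x \<kappa> b] show thesis by simp
qed

lemma continuous_envelope:
  assumes "finite I" "I \<noteq> {}"
  shows "continuous_on A (envelope \<kappa> I b)"
  unfolding envelope_def [abs_def] using assms
proof (induction rule: finite_ne_induct)
  case (insert P I)
  then have "(\<lambda>x. MIN Q\<in>insert P I. oval_radius \<kappa> Q (b Q) x) =
      (\<lambda>x. min (oval_radius \<kappa> P (b P) x) (MIN Q\<in>I. oval_radius \<kappa> Q (b Q) x))"
    by auto
  with insert show ?case by (auto intro!: continuous_intros)
qed (auto intro!: continuous_intros)

context near_field
begin

context
  fixes I and b :: "real ^ 'n \<Rightarrow> real"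
  assumes I: "finite I" "I \<noteq> {}" "I \<subseteq> K" and b: "\<And>P. P \<in> I \<Longrightarrow> \<kappa> * norm P < b P"
begin

lemma oval_radius_pos: "x \<in> E \<Longrightarrow> P \<in> I \<Longrightarrow> 0 < oval_radius \<kappa> P (b P) x"
  using oval_radius_bounds(2)[of x \<kappa> P "b P"] b[of P] kappa
  by (smt (verit) mult_nonneg_nonpos norm_E)

lemma envelope_pos: "x \<in> E \<Longrightarrow> 0 < envelope \<kappa> I b x"
  unfolding envelope_def using I oval_radius_pos by simp

text \<open>
  On the cell of \<open>P\<close> the envelope coincides with the oval of \<open>P\<close>, and elsewhere it stays
  inside that oval.
\<close>

lemma cell_imp_active:
  assumes "x \<in> E" "P \<in> I" "x \<in> cell \<kappa> I b P"
  shows "active \<kappa> E (envelope \<kappa> I b) x P"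
  unfolding active_def
proof
  have bP: "\<kappa> * norm P \<le> b P" using b assms by (simp add: less_imp_le)
  fix y assume y: "y \<in> E"
  have "envelope \<kappa> I b y \<le> oval_radius \<kappa> P (b P) y"
    unfolding envelope_def using I assms by simp
  then have "optical_path \<kappa> (envelope \<kappa> I b y *\<^sub>R y) P \<le> b P"
    using le_oval_radius_iff(1)[of y \<kappa> P "b P" "envelope \<kappa> I b y"] y bP kappa envelope_pos[OF y] by simp
  also have "b P = optical_path \<kappa> (envelope \<kappa> I b x *\<^sub>R x) P"
    using assms bP kappa I mem_cell_iff[of I P] oval_radius_solves(2)[of x \<kappa> P "b P"] by simp
  finally show "optical_path \<kappa> (envelope \<kappa> I b y *\<^sub>R y) P \<le> optical_path \<kappa> (envelope \<kappa> I b x *\<^sub>R x) P" .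
qed

lemma envelope_refractor: "refractor (envelope \<kappa> I b)"
  unfolding refractor_def
proof (intro ballI conjI)
  fix y assume y: "y \<in> E"
  then show "0 < envelope \<kappa> I b y" by (rule envelope_pos)
  obtain P where "P \<in> I" "y \<in> cell \<kappa> I b P"
    using ex_cell I by blast
  then show "\<exists>P\<in>K. active \<kappa> E (envelope \<kappa> I b) y P"
    using cell_imp_active y I by blast
qed

end

end

text \<open>
  The measure \<open>\<nu>\<close> stands for \<open>f dx\<close>, regarded as a Borel measure on the whole space. Of
  surface measure it retains that sets with negligible cones are null, and of \<open>f > 0\<close> that every
  neighbourhood of a point of \<open>E\<close> has positive measure.
\<close>

locale illuminated = near_field \<kappa> \<tau> r\<^sub>0 E K + finite_measure \<nu>
  for \<kappa> \<tau> r\<^sub>0 :: real and E K :: "(real ^ 'n) set" and \<nu> :: "(real ^ 'n) measure" +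
  assumes sets_nu [measurable_cong]: "sets \<nu> = sets borel"
    and AE_E: "AE x in \<nu>. x \<in> E"
    and null: "\<And>N. \<lbrakk>N \<in> sets borel; N \<subseteq> E; negligible {t *\<^sub>R x | t x. x \<in> N \<and> 0 < t \<and> t \<le> 1}\<rbrakk>
        \<Longrightarrow> N \<in> null_sets \<nu>"
    and pos: "\<And>x e. \<lbrakk>x \<in> E; 0 < e\<rbrakk> \<Longrightarrow> 0 < measure \<nu> (ball x e)"
begin

lemma space_nu: "space \<nu> = UNIV"
  using sets_eq_imp_space_eq[OF sets_nu] by simp

lemma multi_active_null:
  assumes "refractor \<rho>"
  shows "multi_active \<rho> \<in> null_sets \<nu>"
proof (rule null)
  show "multi_active \<rho> \<in> sets borel"
    by (intro multi_active_borel refractor_continuous assms)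
  show "negligible {t *\<^sub>R x | t x. x \<in> multi_active \<rho> \<and> 0 < t \<and> t \<le> 1}"
    using assms by (intro negligible_cone_multi_active) (auto simp: refractor_def)
qed (auto simp: multi_active_def)

text \<open>
  The energy that \<open>P\<close> receives when the light in direction \<open>x\<close> is dimmed by a factor
  \<open>\<theta> x r\<close> depending on the radius \<open>r\<close> of the surface in that direction.
\<close>

definition mass where
  "mass \<theta> I P b = (\<integral>x. indicator (cell \<kappa> I b P) x * \<theta> x (oval_radius \<kappa> P (b P) x) \<partial>\<nu>)"

lemma AE_unique_cell:
  assumes "finite I" "I \<noteq> {}" "I \<subseteq> K" "\<And>P. P \<in> I \<Longrightarrow> \<kappa> * norm P < b P"
  shows "AE x in \<nu>. x \<in> E \<and> (envelope \<kappa> I b x \<le> r\<^sub>0 \<longrightarrow> (\<exists>!P. P \<in> I \<and> x \<in> cell \<kappa> I b P))"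
proof -
  note ref = envelope_refractor[OF assms]
  have "AE x in \<nu>. x \<notin> multi_active (envelope \<kappa> I b)"
    using AE_not_in[OF multi_active_null[OF ref]] .
  with AE_E show ?thesis
  proof eventually_elim
    case (elim x)
    obtain P where P: "P \<in> I" "x \<in> cell \<kappa> I b P"
      using ex_cell assms by blast
    have "Q = P" if "Q \<in> I" "x \<in> cell \<kappa> I b Q" "envelope \<kappa> I b x \<le> r\<^sub>0" for Q
    proof (rule ccontr)
      assume "Q \<noteq> P"
      moreover have "active \<kappa> E (envelope \<kappa> I b) x Q" "active \<kappa> E (envelope \<kappa> I b) x P"
        using cell_imp_active[OF assms] elim P that by blast+
      ultimately have "x \<in> multi_active (envelope \<kappa> I b)"
        unfolding multi_active_def using elim that P assms(3) by blast
      with elim show False by blast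
    qed
    with elim P show ?case by blast
  qed
qed

end

section \<open>Finitely many targets and a cutoff\<close>

text \<open>
  Monotonicity in the radius is what keeps the dimmed masses monotone in the levels. The value \<open>1\<close> up to
  \<open>a\<close> prevents the levels from sinking to \<open>\<kappa> |P|\<close>, and the value \<open>0\<close>
  from \<open>c\<close> on removes the part of the surface that is too far out for the cells to be essentially
  disjoint.
\<close>

definition cutoff :: "real \<Rightarrow> real \<Rightarrow> (real ^ 'n \<Rightarrow> real \<Rightarrow> real) \<Rightarrow> bool" where
  "cutoff a c \<theta> \<longleftrightarrow> continuous_on UNIV (\<lambda>(x, r). \<theta> x r) \<and>
     (\<forall>x r. 0 \<le> \<theta> x r \<and> \<theta> x r \<le> 1) \<and> (\<forall>x r r'. r \<le> r' \<longrightarrow> \<theta> x r' \<le> \<theta> x r) \<and>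
     (\<forall>x r. r \<le> a \<longrightarrow> \<theta> x r = 1) \<and> (\<forall>x r. c \<le> r \<longrightarrow> \<theta> x r = 0)"

lemma cutoff_continuous:
  assumes "cutoff a c \<theta>" "continuous_on A g" "continuous_on A h"
  shows "continuous_on A (\<lambda>x. \<theta> (g x) (h x))"
proof -
  have "continuous_on A ((\<lambda>(x, r). \<theta> x r) \<circ> (\<lambda>x. (g x, h x)))"
    using assms unfolding cutoff_def
    by (intro continuous_on_compose continuous_on_Pair) (auto intro: continuous_on_subset)
  then show ?thesis by (simp add: o_def)
qed

context illuminated
begin

context
  fixes \<theta> :: "real ^ 'n \<Rightarrow> real \<Rightarrow> real" and a :: real and I :: "(real ^ 'n) set"
  assumes \<theta>: "cutoff a r\<^sub>0 \<theta>" and a: "0 < a" and I: "finite I" "I \<noteq> {}" "I \<subseteq> K"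
begin

lemma cutoff_simps:
  "0 \<le> \<theta> x r" "\<theta> x r \<le> 1" "r \<le> r' \<Longrightarrow> \<theta> x r' \<le> \<theta> x r" "r \<le> a \<Longrightarrow> \<theta> x r = 1" "r\<^sub>0 \<le> r \<Longrightarrow> \<theta> x r = 0"
  using \<theta> by (auto simp: cutoff_def)

lemma cutoff_measurable:
  assumes "continuous_on UNIV h"
  shows "(\<lambda>x. \<theta> x (h x)) \<in> borel_measurable \<nu>"
proof -
  have "(\<lambda>x. \<theta> x (h x)) \<in> borel_measurable borel"
    by (intro borel_measurable_continuous_onI cutoff_continuous[OF \<theta>] assms continuous_on_id)
  then show ?thesis by (simp add: measurable_cong_sets[OF sets_nu])
qed

lemma mass_integrand_measurable:
  "(\<lambda>x. indicator (cell \<kappa> I b P) x * \<theta> x (oval_radius \<kappa> P (b P) x)) \<in> borel_measurable \<nu>"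
proof -
  have "cell \<kappa> I b P \<in> sets \<nu>"
    unfolding sets_nu by (rule borel_closed[OF closed_cell])
  then show ?thesis
    by (intro borel_measurable_times borel_measurable_indicator cutoff_measurable
        continuous_on_oval_radius continuous_on_id)
qed

lemma mass_integrable:
  "integrable \<nu> (\<lambda>x. indicator (cell \<kappa> I b P) x * \<theta> x (oval_radius \<kappa> P (b P) x))"
  by (rule integrable_const_bound[where B = 1])
    (use cutoff_simps in \<open>auto simp: abs_mult split: split_indicator intro!: mass_integrand_measurable\<close>)

lemma sum_mass:
  assumes b: "\<And>P. P \<in> I \<Longrightarrow> \<kappa> * norm P < b P"
  shows "(\<Sum>P\<in>I. mass \<theta> I P b) = (\<integral>x. \<theta> x (envelope \<kappa> I b x) \<partial>\<nu>)"
proof -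
  have uniq: "AE x in \<nu>. x \<in> E \<and> (envelope \<kappa> I b x \<le> r\<^sub>0 \<longrightarrow> (\<exists>!P. P \<in> I \<and> x \<in> cell \<kappa> I b P))"
    by (rule AE_unique_cell[OF I b])
  have "(\<Sum>P\<in>I. mass \<theta> I P b) =
      (\<integral>x. (\<Sum>P\<in>I. indicator (cell \<kappa> I b P) x * \<theta> x (oval_radius \<kappa> P (b P) x)) \<partial>\<nu>)"
    unfolding mass_def by (rule Bochner_Integration.integral_sum[symmetric]) (rule mass_integrable)
  also have "\<dots> = (\<integral>x. \<theta> x (envelope \<kappa> I b x) \<partial>\<nu>)"
  proof (rule integral_cong_AE)
    show "(\<lambda>x. \<Sum>P\<in>I. indicator (cell \<kappa> I b P) x * \<theta> x (oval_radius \<kappa> P (b P) x)) \<in> borel_measurable \<nu>"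
      by (intro borel_measurable_sum mass_integrand_measurable)
    show "(\<lambda>x. \<theta> x (envelope \<kappa> I b x)) \<in> borel_measurable \<nu>"
      by (intro cutoff_measurable continuous_envelope I)
    show "AE x in \<nu>. (\<Sum>P\<in>I. indicator (cell \<kappa> I b P) x * \<theta> x (oval_radius \<kappa> P (b P) x)) =
        \<theta> x (envelope \<kappa> I b x)"
      using uniq
    proof eventually_elim
      case (elim x)
      have *: "(\<Sum>P\<in>I. indicator (cell \<kappa> I b P) x * \<theta> x (oval_radius \<kappa> P (b P) x)) =
          (\<Sum>P\<in>I. indicator (cell \<kappa> I b P) x * \<theta> x (envelope \<kappa> I b x))"
        by (intro sum.cong refl) (auto simp: mem_cell_iff[OF I(1)] split: split_indicator)
      show ?case
      proof (cases "envelope \<kappa> I b x \<le> r\<^sub>0")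
        case True
        with elim have "\<exists>!P. P \<in> I \<and> x \<in> cell \<kappa> I b P" by simp
        then obtain P where "P \<in> I \<and> x \<in> cell \<kappa> I b P"
          and "\<forall>Q. Q \<in> I \<and> x \<in> cell \<kappa> I b Q \<longrightarrow> Q = P" by (rule ex1E)
        then have P: "P \<in> I" "x \<in> cell \<kappa> I b P"
          "\<And>Q. Q \<in> I \<Longrightarrow> x \<in> cell \<kappa> I b Q \<Longrightarrow> Q = P" by blast+
        have ind: "indicator (cell \<kappa> I b Q) x = (if Q = P then 1 else 0 :: real)" if "Q \<in> I" for Q
        proof (cases "Q = P")
          case False
          then have "x \<notin> cell \<kappa> I b Q" using P(3) that by blast
          with False show ?thesis by simp
        qed (use P(2) in simp)
        have "(\<Sum>P\<in>I. indicator (cell \<kappa> I b P) x * \<theta> x (envelope \<kappa> I b x)) =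
            (\<Sum>Q\<in>I. if Q = P then \<theta> x (envelope \<kappa> I b x) else 0)"
          by (intro sum.cong refl) (simp add: ind)
        then show ?thesis using I(1) P(1) by (simp add: * )
      next
        case False
        then show ?thesis using * cutoff_simps(5)[of "envelope \<kappa> I b x" x] by simp
      qed
    qed
  qed
  finally show ?thesis .
qed

text \<open>
  While the level of \<open>P\<close> is unchanged, so is the dimming on the cell of \<open>P\<close>; raising other
  levels only enlarges that cell.
\<close>

lemma mass_mono:
  assumes P: "P \<in> I" and l: "\<And>Q. Q \<in> I \<Longrightarrow> \<kappa> * norm Q < b Q \<and> b Q \<le> b' Q" and eq: "b P = b' P"
  shows "mass \<theta> I P b \<le> mass \<theta> I P b'"
  unfolding mass_def
proof (rule integral_mono_AE[OF mass_integrable mass_integrable])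
  show "AE x in \<nu>. indicator (cell \<kappa> I b P) x * \<theta> x (oval_radius \<kappa> P (b P) x)
      \<le> indicator (cell \<kappa> I b' P) x * \<theta> x (oval_radius \<kappa> P (b' P) x)"
    using AE_E
  proof eventually_elim
    case (elim x)
    have "x \<in> cell \<kappa> I b' P" if x: "x \<in> cell \<kappa> I b P"
      unfolding cell_def
    proof (intro CollectI ballI)
      fix Q assume Q: "Q \<in> I"
      have "oval_radius \<kappa> P (b P) x \<le> oval_radius \<kappa> Q (b Q) x"
        using x Q by (auto simp: cell_def)
      also have "\<dots> \<le> oval_radius \<kappa> Q (b' Q) x"
        using l[OF Q] elim kappa by (intro oval_radius_mono) auto
      finally show "oval_radius \<kappa> P (b' P) x \<le> oval_radius \<kappa> Q (b' Q) x"
        using eq by simp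
    qed
    then show ?case using eq cutoff_simps(1) by (auto split: split_indicator)
  qed
qed

lemma oval_radius_tendsto:
  assumes "x \<in> E" "\<And>n. \<kappa> * norm P \<le> c n" "c \<longlonglongrightarrow> b"
  shows "(\<lambda>n. oval_radius \<kappa> P (c n) x) \<longlonglongrightarrow> oval_radius \<kappa> P b x"
  unfolding oval_radius_def divide_inverse by (intro tendsto_intros assms)

text \<open>
  The integrands converge in every direction with a single cell, and in every direction where the cutoff vanishes in
  the limit. By \<open>AE_unique_cell\<close> almost every direction is of one of these kinds.
\<close>

lemma mass_tendsto:
  assumes P: "P \<in> I" and c: "\<And>n Q. Q \<in> I \<Longrightarrow> \<kappa> * norm Q < c n Q" and b: "\<And>Q. Q \<in> I \<Longrightarrow> \<kappa> * norm Q < b Q"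
    and lim: "\<And>Q. Q \<in> I \<Longrightarrow> (\<lambda>n. c n Q) \<longlonglongrightarrow> b Q"
  shows "(\<lambda>n. mass \<theta> I P (c n)) \<longlonglongrightarrow> mass \<theta> I P b"
proof -
  have uniq: "AE x in \<nu>. x \<in> E \<and> (envelope \<kappa> I b x \<le> r\<^sub>0 \<longrightarrow> (\<exists>!P. P \<in> I \<and> x \<in> cell \<kappa> I b P))"
    by (rule AE_unique_cell[OF I b])
  show ?thesis
    unfolding mass_def
  proof (rule integral_dominated_convergence[where w = "\<lambda>_. 1"])
    show "AE x in \<nu>. (\<lambda>n. indicator (cell \<kappa> I (c n) P) x * \<theta> x (oval_radius \<kappa> P (c n P) x))
        \<longlonglongrightarrow> indicator (cell \<kappa> I b P) x * \<theta> x (oval_radius \<kappa> P (b P) x)"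
      using uniq
    proof eventually_elim
      case (elim x)
      have or: "(\<lambda>n. oval_radius \<kappa> Q (c n Q) x) \<longlonglongrightarrow> oval_radius \<kappa> Q (b Q) x" if "Q \<in> I" for Q
        using that elim c lim by (intro oval_radius_tendsto) (auto intro: less_imp_le)
      have "continuous_on UNIV (\<lambda>r. \<theta> x r)"
        by (intro cutoff_continuous[OF \<theta>] continuous_on_const continuous_on_id)
      then have \<theta>lim: "(\<lambda>n. \<theta> x (oval_radius \<kappa> P (c n P) x)) \<longlonglongrightarrow> \<theta> x (oval_radius \<kappa> P (b P) x)"
        using or[OF P] by (auto intro: continuous_on_tendsto_compose)
      show ?case
      proof (cases "x \<in> cell \<kappa> I b P")
        case False
        then obtain Q where Q: "Q \<in> I" "oval_radius \<kappa> Q (b Q) x < oval_radius \<kappa> P (b P) x"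
          by (auto simp: cell_def not_le)
        have "\<forall>\<^sub>F n in sequentially. oval_radius \<kappa> Q (c n Q) x < oval_radius \<kappa> P (c n P) x"
          using order_tendstoD(1)[OF tendsto_diff[OF or[OF P] or[OF Q(1)]], of 0] Q(2) by simp
        then have "\<forall>\<^sub>F n in sequentially. indicator (cell \<kappa> I (c n) P) x * \<theta> x (oval_radius \<kappa> P (c n P) x) = 0"
          by eventually_elim (use Q in \<open>force simp: cell_def split: split_indicator\<close>)
        then show ?thesis using False by (simp add: tendsto_eventually)
      next
        case True
        show ?thesis
        proof (cases "oval_radius \<kappa> P (b P) x \<le> r\<^sub>0")
          case False
          then have "(\<lambda>n. \<theta> x (oval_radius \<kappa> P (c n P) x)) \<longlonglongrightarrow> 0"
            using \<theta>lim cutoff_simps(5)[of "oval_radius \<kappa> P (b P) x" x] by simp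
          then have "(\<lambda>n. indicator (cell \<kappa> I (c n) P) x * \<theta> x (oval_radius \<kappa> P (c n P) x)) \<longlonglongrightarrow> 0"
            by (rule Lim_null_comparison[rotated])
              (intro always_eventually allI, simp add: cutoff_simps(1) split: split_indicator)
          then show ?thesis using False cutoff_simps(5)[of "oval_radius \<kappa> P (b P) x" x] by simp
        next
          case le: True
          have less: "oval_radius \<kappa> P (b P) x < oval_radius \<kappa> Q (b Q) x" if "Q \<in> I" "Q \<noteq> P" for Q
          proof (rule ccontr)
            assume "\<not> ?thesis"
            moreover have "oval_radius \<kappa> P (b P) x \<le> oval_radius \<kappa> Q (b Q) x"
              using True that by (auto simp: cell_def)
            ultimately have "oval_radius \<kappa> Q (b Q) x = oval_radius \<kappa> P (b P) x" by simp
            then have "x \<in> cell \<kappa> I b Q" using True by (simp add: cell_def)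
            moreover have "envelope \<kappa> I b x \<le> r\<^sub>0"
              using le True mem_cell_iff[OF I(1) P] by simp
            ultimately show False using elim True P that by blast
          qed
          have "\<forall>\<^sub>F n in sequentially. oval_radius \<kappa> P (c n P) x \<le> oval_radius \<kappa> Q (c n Q) x" if "Q \<in> I" for Q
          proof (cases "Q = P")
            case False
            have "\<forall>\<^sub>F n in sequentially. oval_radius \<kappa> P (c n P) x < oval_radius \<kappa> Q (c n Q) x"
              using order_tendstoD(1)[OF tendsto_diff[OF or[OF that] or[OF P]], of 0] less[OF that False] by simp
            then show ?thesis by (rule eventually_mono) simp
          qed simp
          then have "\<forall>\<^sub>F n in sequentially. \<forall>Q\<in>I. oval_radius \<kappa> P (c n P) x \<le> oval_radius \<kappa> Q (c n Q) x"
            using I by (simp add: eventually_ball_finite)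
          then have "\<forall>\<^sub>F n in sequentially. \<theta> x (oval_radius \<kappa> P (c n P) x) =
              indicator (cell \<kappa> I (c n) P) x * \<theta> x (oval_radius \<kappa> P (c n P) x)"
            by eventually_elim (simp add: cell_def)
          then show ?thesis
            using True Lim_transform_eventually[OF \<theta>lim] by simp
        qed
      qed
    qed
    show "AE x in \<nu>. norm (indicator (cell \<kappa> I (c n) P) x * \<theta> x (oval_radius \<kappa> P (c n P) x)) \<le> 1" for n
      using cutoff_simps by (auto split: split_indicator)
  qed (auto intro!: mass_integrand_measurable)
qed

text \<open>
  If some oval lay within radius \<open>a\<close>, no light would be dimmed and the total mass would be that of
  \<open>\<nu>\<close>, more than prescribed. So admissible levels stay away from \<open>\<kappa> |P|\<close>, and
  \<open>exists_levels_with_masses\<close> applies.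
\<close>

lemma exists_envelope_with_masses:
  assumes m: "\<And>P. P \<in> I \<Longrightarrow> 0 \<le> m P" "sum m I < measure \<nu> UNIV"
  obtains b where "\<And>P. P \<in> I \<Longrightarrow> \<kappa> * norm P < b P" "\<And>P. P \<in> I \<Longrightarrow> mass \<theta> I P b = m P"
proof -
  define l where "l P = \<kappa> * norm P + (1 - \<kappa>) * a" for P :: "real ^ 'n"
  have ll: "\<kappa> * norm P < l P" for P
    using a kappa by (simp add: l_def)
  define W where "W = {b. \<forall>P\<in>I. l P \<le> b P \<and> mass \<theta> I P b \<le> m P}"
  show thesis
  proof (rule exists_levels_with_masses[where I = I and l = l and m = m and M = "mass \<theta> I", OF I(1) _ _ W_def])
    show "mass \<theta> I P b \<le> mass \<theta> I P b'"
      if "P \<in> I" "\<And>Q. Q \<in> I \<Longrightarrow> l Q \<le> b Q \<and> b Q \<le> b' Q" "b P = b' P" for P b b'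
      using that ll less_le_trans by (intro mass_mono) blast+
    show "(\<lambda>n. mass \<theta> I P (c n)) \<longlonglongrightarrow> mass \<theta> I P b"
      if "P \<in> I" "\<And>n Q. Q \<in> I \<Longrightarrow> l Q \<le> c n Q" "\<And>Q. Q \<in> I \<Longrightarrow> (\<lambda>n. c n Q) \<longlonglongrightarrow> b Q" for P b c
    proof (rule mass_tendsto[OF that(1) _ _ that(3)])
      show "\<kappa> * norm Q < c n Q" if "Q \<in> I" for n Q
        using \<open>\<And>n Q. Q \<in> I \<Longrightarrow> l Q \<le> c n Q\<close>[OF that] ll less_le_trans by blast
      have "l Q \<le> b Q" if "Q \<in> I" for Q
        using \<open>\<And>n Q. Q \<in> I \<Longrightarrow> l Q \<le> c n Q\<close>[OF that] Lim_bounded2[OF \<open>\<And>Q. Q \<in> I \<Longrightarrow> (\<lambda>n. c n Q) \<longlonglongrightarrow> b Q\<close>[OF that]] by blast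
      then show "\<kappa> * norm Q < b Q" if "Q \<in> I" for Q
        using that ll less_le_trans by blast
    qed
    show "W \<noteq> {}"
    proof -
      \<comment> \<open>Ovals beyond radius \<open>r\<^sub>0\<close> receive nothing, since the cutoff vanishes there.\<close>
      define b where "b P = \<kappa> * norm P + (1 + \<kappa>) * max a r\<^sub>0" for P :: "real ^ 'n"
      have kb: "\<kappa> * norm P < b P" for P
        using kappa a by (simp add: b_def)
      have big: "max a r\<^sub>0 \<le> oval_radius \<kappa> P (b P) x" if "x \<in> E" for x P
        using oval_radius_bounds(2)[of x \<kappa> P "b P"] that kb[of P] kappa
        by (auto simp: b_def intro: less_imp_le)
      have "mass \<theta> I P b = 0" for P
      proof -
        have "mass \<theta> I P b = (\<integral>x. 0 \<partial>\<nu>)"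
          unfolding mass_def
        proof (rule integral_cong_AE[OF mass_integrand_measurable])
          show "AE x in \<nu>. indicator (cell \<kappa> I b P) x * \<theta> x (oval_radius \<kappa> P (b P) x) = 0"
            using AE_E
          proof eventually_elim
            case (elim x)
            then show ?case using big[OF elim, of P] cutoff_simps(5) by simp
          qed
        qed simp
        then show ?thesis by simp
      qed
      moreover have "l P \<le> b P" for P
      proof -
        have "(1 - \<kappa>) * a \<le> (1 + \<kappa>) * max a r\<^sub>0"
          using kappa a by (intro mult_mono) auto
        then show ?thesis by (simp add: l_def b_def)
      qed
      ultimately have "b \<in> W" using m by (simp add: W_def)
      then show ?thesis by blast
    qed
    show "l P < b P" if "b \<in> W" "P \<in> I" for b P
    proof (rule ccontr)
      assume "\<not> l P < b P"
      with that have bP: "b P = l P" by (force simp: W_def)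
      have kb: "\<kappa> * norm Q < b Q" if "Q \<in> I" for Q
        using \<open>b \<in> W\<close> that ll less_le_trans by (fastforce simp: W_def)
      have "(\<Sum>P\<in>I. mass \<theta> I P b) = (\<integral>x. \<theta> x (envelope \<kappa> I b x) \<partial>\<nu>)"
        by (rule sum_mass[OF kb])
      also have "\<dots> = (\<integral>x. 1 \<partial>\<nu>)"
      proof (rule integral_cong_AE)
        show "AE x in \<nu>. \<theta> x (envelope \<kappa> I b x) = 1"
          using AE_E
        proof eventually_elim
          case (elim x)
          have "envelope \<kappa> I b x \<le> oval_radius \<kappa> P (b P) x"
            unfolding envelope_def using I that by simp
          moreover have "(1 - \<kappa>) * oval_radius \<kappa> P (b P) x \<le> (1 - \<kappa>) * a"
            using oval_radius_bounds(1)[of x \<kappa> P "b P"] elim kb[OF that(2)] kappa bP by (simp add: l_def)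
          then have "oval_radius \<kappa> P (b P) x \<le> a" using kappa by simp
          ultimately show ?case using cutoff_simps(4) by simp
        qed
      qed (auto intro!: cutoff_measurable continuous_envelope I)
      finally have "measure \<nu> UNIV = (\<Sum>P\<in>I. mass \<theta> I P b)" by (simp add: space_nu)
      also have "\<dots> \<le> sum m I"
        using \<open>b \<in> W\<close> by (intro sum_mono) (auto simp: W_def)
      finally show False using m by simp
    qed
  qed (use that ll less_trans in blast)
qed

end

end

section \<open>Passing close to a given point\<close>

context illuminated
begin

lemma cell_measure_sum:
  assumes I: "finite I" "I \<noteq> {}" "I \<subseteq> K" and b: "\<And>P. P \<in> I \<Longrightarrow> \<kappa> * norm P < b P"
    and le: "\<And>x. x \<in> E \<Longrightarrow> envelope \<kappa> I b x \<le> r\<^sub>0"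
  shows "(\<Sum>P\<in>I. measure \<nu> (cell \<kappa> I b P)) = measure \<nu> UNIV"
proof -
  have sets: "cell \<kappa> I b P \<in> sets \<nu>" for P
    unfolding sets_nu by (rule borel_closed[OF closed_cell])
  have uniq: "AE x in \<nu>. x \<in> E \<and> (envelope \<kappa> I b x \<le> r\<^sub>0 \<longrightarrow> (\<exists>!P. P \<in> I \<and> x \<in> cell \<kappa> I b P))"
    by (rule AE_unique_cell[OF I b])
  have "(\<Sum>P\<in>I. measure \<nu> (cell \<kappa> I b P)) = measure \<nu> (\<Union>P\<in>I. cell \<kappa> I b P)"
  proof (rule measure_UNION_AE[symmetric])
    show "pairwise (\<lambda>P Q. AE x in \<nu>. x \<notin> cell \<kappa> I b P \<or> x \<notin> cell \<kappa> I b Q) I"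
    proof (rule pairwiseI)
      fix P Q assume PQ: "P \<in> I" "Q \<in> I" "P \<noteq> Q"
      show "AE x in \<nu>. x \<notin> cell \<kappa> I b P \<or> x \<notin> cell \<kappa> I b Q"
        using uniq by eventually_elim (use PQ le in blast)
    qed
  qed (use I(1) sets in \<open>auto simp: fmeasurable_eq_sets\<close>)
  also have "(\<Union>P\<in>I. cell \<kappa> I b P) = UNIV"
    using ex_cell[OF I(1,2)] by blast
  finally show ?thesis .
qed

text \<open>
  The cutoff switches from \<open>1\<close> to \<open>0\<close> between the radii \<open>g x - d\<close> and \<open>g
  x\<close>, where \<open>g\<close> is a cone of slope \<open>A\<close> over \<open>x0\<close> truncated at
  \<open>r\<^sub>0\<close>. A fraction \<open>s\<close> of the energy is lost in the cutoff. As some is lost, the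
  surface exceeds \<open>g - d\<close> at some \<open>x\<close>; by the Harnack inequality this happens close to
  \<open>x0\<close> if \<open>A\<close> is large, so the surface is not far below \<open>a\<close> at
  \<open>x0\<close>. If it were far above \<open>a\<close> at \<open>x0\<close>, it would by the Lipschitz bound be
  above \<open>g\<close> on a ball whose size \<open>\<eta>\<close> does not depend on the targets, and all the energy
  \<open>\<beta>\<close> of the ball would be lost; so \<open>s\<close> is chosen with \<open>s * tot <
  \<beta>\<close>.
\<close>

lemma exists_discrete_refractor:
  assumes x0: "x0 \<in> E" and a: "0 < a" "(1 + \<kappa>) * a < (1 - \<kappa>) * r\<^sub>0" and e: "0 < e"
    and I: "finite I" "I \<noteq> {}" "I \<subseteq> K" and w: "\<And>P. P \<in> I \<Longrightarrow> 0 \<le> w P" "sum w I = measure \<nu> UNIV"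
  obtains b where "\<And>P. P \<in> I \<Longrightarrow> \<kappa> * norm P < b P" "\<bar>envelope \<kappa> I b x0 - a\<bar> \<le> e"
    "\<And>x. x \<in> E \<Longrightarrow> envelope \<kappa> I b x < r\<^sub>0"
    "(\<Sum>P\<in>I. \<bar>measure \<nu> (cell \<kappa> I b P) - w P\<bar>) \<le> e"
proof -
  define C where "C = (1 + \<kappa>) / (1 - \<kappa>)"
  define c where "c = \<kappa> / (1 - \<kappa>)"
  have C: "1 \<le> C" and c: "0 < c" using kappa by (auto simp: C_def c_def)
  have Ca: "C * a < r\<^sub>0" using a kappa by (simp add: C_def field_simps)
  \<comment> \<open>Small enough for the surface to stay below \<open>r\<^sub>0 - d\<close> once its radius at \<open>x0\<close> is at most \<open>a + 2 * d\<close>.\<close>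
  define d where "d = min (e / 2) ((r\<^sub>0 - C * a) / (2 * C + 2))"
  have d: "0 < d" "2 * d \<le> e"
    using e Ca C by (auto simp: d_def)
  have "d \<le> (r\<^sub>0 - C * a) / (2 * C + 2)" by (simp add: d_def)
  then have "d * (2 * C + 2) \<le> r\<^sub>0 - C * a"
    using C by (simp add: pos_le_divide_eq)
  then have Cd: "C * (a + 2 * d) + d < r\<^sub>0"
    using d by (simp add: algebra_simps)
  have "1 * (a + 2 * d) \<le> C * (a + 2 * d)"
    using C a d by (intro mult_right_mono) auto
  with Cd have ad: "a + 2 * d + d < r\<^sub>0" by simp
  \<comment> \<open>With this slope, points with \<open>A * norm (x - x0) \<le> r\<^sub>0\<close> have radii within \<open>e\<close> of the radius at \<open>x0\<close>.\<close>
  define A where "A = c * r\<^sub>0 * r\<^sub>0 / e"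
  have A: "0 < A" using c r0 e by (simp add: A_def)
  define g where "g x = min (a + d + A * norm (x - x0)) r\<^sub>0" for x
  define \<theta> where "\<theta> x r = max 0 (min 1 ((g x - r) / d))" for x r
  \<comment> \<open>Makes the Lipschitz loss plus the rise of the cone over distance \<open>\<eta>\<close> equal to \<open>d\<close>.\<close>
  define \<eta> where "\<eta> = d / ((a + 2 * d) * c + A)"
  have den: "0 < (a + 2 * d) * c + A" using a d c A by (simp add: add_pos_pos)
  have "((a + 2 * d) * c + A) * \<eta> = d"
    using den by (simp add: \<eta>_def)
  then have \<eta>: "0 < \<eta>" "(a + 2 * d) * c * \<eta> + A * \<eta> = d"
    using d den by (simp add: \<eta>_def, simp only: distrib_right)
  define tot where "tot = measure \<nu> UNIV"
  define \<beta> where "\<beta> = measure \<nu> (ball x0 \<eta>)"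
  have \<beta>: "0 < \<beta>" unfolding \<beta>_def by (rule pos[OF x0 \<eta>(1)])
  have "\<beta> \<le> tot" unfolding \<beta>_def tot_def
    by (rule finite_measure_mono) (auto simp: sets_nu)
  with \<beta> have tot: "0 < tot" by simp
  define s where "s = min (1/2) (min (\<beta> / (2 * tot)) (e / (2 * tot)))"
  have s: "0 < s" "s < 1" "s * tot < \<beta>" "2 * s * tot \<le> e"
  proof -
    show "0 < s" "s < 1" using \<beta> tot e by (auto simp: s_def)
    have "s \<le> \<beta> / (2 * tot)" "s \<le> e / (2 * tot)" by (auto simp: s_def)
    then have "s * (2 * tot) \<le> \<beta>" "s * (2 * tot) \<le> e" using tot by (auto simp: pos_le_divide_eq)
    then show "s * tot < \<beta>" "2 * s * tot \<le> e" using \<beta> by (auto simp: algebra_simps)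
  qed
  have cut: "cutoff a r\<^sub>0 \<theta>"
    unfolding cutoff_def
  proof (intro conjI allI impI)
    show "continuous_on UNIV (\<lambda>(x, r). \<theta> x r)"
      unfolding \<theta>_def g_def case_prod_beta divide_inverse by (intro continuous_intros)
    show "\<theta> x r' \<le> \<theta> x r" if "r \<le> r'" for x r r'
    proof -
      have "(g x - r') / d \<le> (g x - r) / d" using that d by (intro divide_right_mono) auto
      then show ?thesis by (auto simp: \<theta>_def)
    qed
    show "\<theta> x r = 1" if "r \<le> a" for x r
    proof -
      have "a + d \<le> g x" using ad d A by (auto simp: g_def)
      then have "1 \<le> (g x - r) / d" using that d by (simp add: pos_le_divide_eq)
      then show ?thesis by (simp add: \<theta>_def)
    qed
    show "\<theta> x r = 0" if "r\<^sub>0 \<le> r" for x r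
    proof -
      have "g x \<le> r" using that by (auto simp: g_def)
      then have "(g x - r) / d \<le> 0" using d by (simp add: divide_nonpos_pos)
      then show ?thesis by (simp add: \<theta>_def)
    qed
  qed (auto simp: \<theta>_def)
  have m: "0 \<le> (1 - s) * w P" if "P \<in> I" for P using w that s by simp
  have m_sum: "(\<Sum>P\<in>I. (1 - s) * w P) = (1 - s) * tot"
    unfolding sum_distrib_left[symmetric] w tot_def ..
  have "(1 - s) * tot < 1 * tot" using s tot by (intro mult_strict_right_mono) auto
  then have m_less: "(\<Sum>P\<in>I. (1 - s) * w P) < measure \<nu> UNIV"
    unfolding m_sum by (simp add: tot_def)
  obtain b where b: "\<And>P. P \<in> I \<Longrightarrow> \<kappa> * norm P < b P"
    and mass: "\<And>P. P \<in> I \<Longrightarrow> mass \<theta> I P b = (1 - s) * w P"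
    using exists_envelope_with_masses[OF cut a(1) I m m_less] by blast
  define \<rho> where "\<rho> = envelope \<kappa> I b"
  have ref: "refractor \<rho>" unfolding \<rho>_def by (rule envelope_refractor[OF I b])
  have \<rho>0: "0 < \<rho> x0" using ref x0 by (simp add: refractor_def)
  have int_\<theta>: "(\<integral>x. \<theta> x (\<rho> x) \<partial>\<nu>) = (1 - s) * tot"
    using sum_mass[OF cut a(1) I b] mass m_sum unfolding \<rho>_def by simp
  have \<theta>_meas: "(\<lambda>x. \<theta> x (\<rho> x)) \<in> borel_measurable \<nu>"
    unfolding \<rho>_def by (intro cutoff_measurable[OF cut a(1) I] continuous_envelope I)
  have \<theta>01: "0 \<le> \<theta> x r" "\<theta> x r \<le> 1" for x r by (auto simp: \<theta>_def)
  have lip: "\<bar>\<rho> x - \<rho> y\<bar> \<le> c * \<rho> y * norm (x - y)" if "x \<in> E" "y \<in> E" for x y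
    using refractor_lipschitz[OF ref that] kappa by (simp add: c_def field_simps)
  have har: "\<rho> x \<le> C * \<rho> y" if "x \<in> E" "y \<in> E" for x y
    using refractor_harnack[OF ref that] kappa by (simp add: C_def field_simps)
  have upper: "\<rho> x0 \<le> a + 2 * d"
  proof (rule ccontr)
    assume "\<not> ?thesis"
    then have big: "a + 2 * d < \<rho> x0" by simp
    have zero: "\<theta> x (\<rho> x) = 0" if x: "x \<in> E" "x \<in> ball x0 \<eta>" for x
    proof -
      have n: "norm (x - x0) \<le> \<eta>" using x by (simp add: dist_norm norm_minus_commute)
      have c\<eta>: "c * \<eta> \<le> 1"
      proof -
        have "(a + 2 * d) * (c * \<eta>) \<le> (a + 2 * d) * 1"
          using \<eta> A d a by (smt (verit, best) mult.assoc mult_pos_pos mult.right_neutral)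
        then show ?thesis using a d by (subst (asm) mult_le_cancel_left_pos) auto
      qed
      have "c * \<rho> x0 * norm (x - x0) \<le> c * \<rho> x0 * \<eta>"
        using n c \<rho>0 by (intro mult_left_mono) auto
      then have "\<rho> x0 * (1 - c * \<eta>) \<le> \<rho> x"
        using lip[OF x(1) x0] by (simp add: algebra_simps)
      moreover have "(a + 2 * d) * (1 - c * \<eta>) \<le> \<rho> x0 * (1 - c * \<eta>)"
        using big c\<eta> by (intro mult_right_mono) auto
      ultimately have "a + d + A * \<eta> \<le> \<rho> x"
        using \<eta>(2) by (simp add: algebra_simps)
      moreover have "A * norm (x - x0) \<le> A * \<eta>" using n A by simp
      ultimately have "g x \<le> \<rho> x" by (simp add: g_def)
      then have "(g x - \<rho> x) / d \<le> 0" using d by (simp add: divide_nonpos_pos)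
      then show ?thesis by (simp add: \<theta>_def)
    qed
    have meas: "ball x0 \<eta> \<in> sets \<nu>" by (simp add: sets_nu)
    have "(\<integral>x. \<theta> x (\<rho> x) \<partial>\<nu>) \<le> (\<integral>x. 1 - indicator (ball x0 \<eta>) x \<partial>\<nu>)"
    proof (rule integral_mono_AE)
      show "integrable \<nu> (\<lambda>x. \<theta> x (\<rho> x))"
        by (rule integrable_const_bound[where B = 1]) (use \<theta>01 \<theta>_meas in auto)
      show "integrable \<nu> (\<lambda>x. 1 - indicator (ball x0 \<eta>) x :: real)"
        using meas by (intro Bochner_Integration.integrable_diff) (auto simp: less_top[symmetric])
      show "AE x in \<nu>. \<theta> x (\<rho> x) \<le> 1 - indicator (ball x0 \<eta>) x"
        using AE_E by eventually_elim (use zero \<theta>01 in \<open>auto split: split_indicator\<close>)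
    qed
    also have "\<dots> = tot - \<beta>"
      using meas by (simp add: Bochner_Integration.integral_diff space_nu tot_def \<beta>_def less_top[symmetric])
    finally show False using s int_\<theta> by (simp add: algebra_simps)
  qed
  have below: "\<rho> x < r\<^sub>0 - d" if "x \<in> E" for x
  proof -
    have "\<rho> x \<le> C * \<rho> x0" by (rule har[OF that x0])
    also have "\<dots> \<le> C * (a + 2 * d)" using upper C by (intro mult_left_mono) auto
    finally show ?thesis using Cd by simp
  qed
  have "\<exists>x\<in>E. \<theta> x (\<rho> x) \<noteq> 1"
  proof (rule ccontr)
    assume "\<not> ?thesis"
    then have "AE x in \<nu>. \<theta> x (\<rho> x) = 1" using AE_E by auto
    then have "(\<integral>x. \<theta> x (\<rho> x) \<partial>\<nu>) = (\<integral>x. 1 \<partial>\<nu>)"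
      using \<theta>_meas by (intro integral_cong_AE) auto
    then show False using int_\<theta> s tot by (simp add: tot_def space_nu)
  qed
  then obtain x where "x \<in> E" "\<theta> x (\<rho> x) \<noteq> 1" by blast
  then have x: "x \<in> E" "\<theta> x (\<rho> x) < 1" using \<theta>01(2)[of x "\<rho> x"] by auto
  have "(g x - \<rho> x) / d < 1" using x(2) by (auto simp: \<theta>_def max_def min_def split: if_splits)
  then have "g x < \<rho> x + d" using d by (simp add: pos_divide_less_eq)
  with below[OF x(1)] have \<rho>x: "a + A * norm (x - x0) < \<rho> x"
    by (auto simp: g_def min_def split: if_splits)
  have lower: "a - e \<le> \<rho> x0"
  proof -
    have r: "\<rho> x < r\<^sub>0" "0 < \<rho> x" using below[OF x(1)] d ref x by (auto simp: refractor_def)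
    have "A * norm (x - x0) \<le> r\<^sub>0" using \<rho>x r a by simp
    then have n: "norm (x - x0) \<le> r\<^sub>0 / A" using A by (simp add: pos_le_divide_eq mult.commute)
    have "c * \<rho> x * norm (x0 - x) \<le> c * r\<^sub>0 * (r\<^sub>0 / A)"
      using n r c r0 by (intro mult_mono) (auto simp: norm_minus_commute)
    also have "\<dots> = e" using c r0 e by (simp add: A_def)
    moreover have "a \<le> \<rho> x" using \<rho>x A by (smt (verit) norm_ge_zero mult_nonneg_nonneg)
    ultimately show ?thesis using lip[OF x0 x(1)] by simp
  qed
  have lt: "\<rho> x < r\<^sub>0" if "x \<in> E" for x using below[OF that] d by simp
  have cells: "(\<Sum>P\<in>I. measure \<nu> (cell \<kappa> I b P)) = tot"
    unfolding tot_def by (rule cell_measure_sum[OF I b]) (use lt in \<open>auto simp: \<rho>_def less_imp_le\<close>)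
  have mass_le: "(1 - s) * w P \<le> measure \<nu> (cell \<kappa> I b P)" if "P \<in> I" for P
  proof -
    have cs: "cell \<kappa> I b P \<in> sets \<nu>"
      unfolding sets_nu by (rule borel_closed[OF closed_cell])
    have ci: "integrable \<nu> (indicat_real (cell \<kappa> I b P))"
      by (rule integrable_real_indicator[OF cs]) (simp add: less_top[symmetric])
    have "mass \<theta> I P b \<le> (\<integral>x. indicator (cell \<kappa> I b P) x \<partial>\<nu>)"
      unfolding mass_def
      by (rule integral_mono_AE[OF mass_integrable[OF cut a(1) I] ci])
        (use \<theta>01 in \<open>auto split: split_indicator\<close>)
    then show ?thesis using mass that cs by (simp add: space_nu)
  qed
  \<comment> \<open>The cell of \<open>P\<close> holds at least its dimmed mass, so the sum of the errors is controlled by the difference of the totals.\<close>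
  have "(\<Sum>P\<in>I. \<bar>measure \<nu> (cell \<kappa> I b P) - w P\<bar>) \<le>
      (\<Sum>P\<in>I. (measure \<nu> (cell \<kappa> I b P) - (1 - s) * w P) + s * w P)"
  proof (rule sum_mono)
    fix P assume P: "P \<in> I"
    have "0 \<le> s * w P" using w P s by simp
    then show "\<bar>measure \<nu> (cell \<kappa> I b P) - w P\<bar> \<le> (measure \<nu> (cell \<kappa> I b P) - (1 - s) * w P) + s * w P"
      using mass_le[OF P] by (simp add: algebra_simps)
  qed
  also have "\<dots> = 2 * s * tot"
    unfolding sum.distrib sum_subtractf cells m_sum
    by (simp add: sum_distrib_left[symmetric] w tot_def[symmetric] algebra_simps)
  also have "\<dots> \<le> e" by (rule s)
  finally have err: "(\<Sum>P\<in>I. \<bar>measure \<nu> (cell \<kappa> I b P) - w P\<bar>) \<le> e" .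
  show thesis
    using that[OF b _ _ err] upper lower lt d by (simp add: \<rho>_def)
qed

end

section \<open>Passage to the limit\<close>

text \<open>
  Continuous functions with values in the unit interval decrease to the indicator of a closed set, and closed sets
  generate the Borel sets.
\<close>

lemma finite_borel_measure_eqI:
  fixes M N :: "'a::metric_space measure"
  assumes fin: "finite_measure M" "finite_measure N" and sets: "sets M = sets borel" "sets N = sets borel"
    and eq: "\<And>g. \<lbrakk>continuous_on UNIV g; \<And>x. 0 \<le> g x \<and> g x \<le> 1\<rbrakk> \<Longrightarrow> (\<integral>x. g x \<partial>M) = (\<integral>x. g x \<partial>N :: real)"
  shows "M = N"
proof -
  interpret M: finite_measure M by fact
  interpret N: finite_measure N by fact
  have closed_eq: "emeasure M F = emeasure N F" if F: "closed F" for F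
  proof (cases "F = {}")
    case False
    define g where "g n x = max 0 (1 - real n * infdist x F)" for n x
    have cont: "continuous_on UNIV (g n)" for n
      unfolding g_def [abs_def] by (intro continuous_intros)
    have g01: "0 \<le> g n x \<and> g n x \<le> 1" for n x
      by (auto simp: g_def infdist_nonneg)
    have lim: "(\<lambda>n. g n x) \<longlonglongrightarrow> indicator F x" for x
    proof (cases "x \<in> F")
      case True
      then show ?thesis by (simp add: g_def)
    next
      case out: False
      then have pos: "0 < infdist x F"
        using F False by (simp add: in_closed_iff_infdist_zero infdist_nonneg less_le)
      obtain n0 where n0: "1 < real n0 * infdist x F"
        using reals_Archimedean3[OF pos] by blast
      have "g n x = 0" if "n0 \<le> n" for n
      proof -
        have "real n0 * infdist x F \<le> real n * infdist x F"
          using that pos by (intro mult_right_mono) auto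
        with n0 show ?thesis by (simp add: g_def)
      qed
      then have "\<forall>\<^sub>F n in sequentially. g n x = indicator F x"
        unfolding eventually_sequentially using out by auto
      then show ?thesis by (rule tendsto_eventually)
    qed
    have int_lim: "(\<lambda>n. \<integral>x. g n x \<partial>L) \<longlonglongrightarrow> measure L F" if "finite_measure L" "sets L = sets borel" for L
    proof -
      interpret L: finite_measure L by fact
      have "(\<lambda>n. \<integral>x. g n x \<partial>L) \<longlonglongrightarrow> (\<integral>x. indicator F x \<partial>L)"
      proof (rule integral_dominated_convergence[where w = "\<lambda>_. 1"])
        show "g n \<in> borel_measurable L" for n
          using borel_measurable_continuous_onI[OF cont] by (simp add: measurable_cong_sets[OF that(2)])
        show "(\<lambda>x. indicator F x :: real) \<in> borel_measurable L"
          using F by (intro borel_measurable_indicator) (simp add: that(2) borel_closed)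
      qed (use lim g01 in auto)
      also have "(\<integral>x. indicator F x \<partial>L) = measure L F"
        using F sets_eq_imp_space_eq[OF that(2)] by (simp add: that(2) borel_closed)
      finally show ?thesis .
    qed
    have "measure M F = measure N F"
      using LIMSEQ_unique[OF int_lim[OF fin(1) sets(1)]] int_lim[OF fin(2) sets(2)] eq[OF cont g01] by simp
    then show ?thesis by (simp add: M.emeasure_eq_measure N.emeasure_eq_measure)
  qed simp
  have borel: "sets borel = sigma_sets UNIV (Collect closed :: 'a set set)"
    unfolding borel_eq_closed by (simp add: sets_measure_of)
  show ?thesis
    by (rule measure_eqI_generator_eq[where E = "Collect closed" and \<Omega> = UNIV and A = "\<lambda>_. UNIV"])
      (auto simp: Int_stable_def closed_eq sets borel)
qed

context near_field
begin

text \<open>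
  Limits of active targets are active, and in \<open>K\<close>; uniqueness of the active target at \<open>x\<close>
  then forces convergence. With varying surfaces and fixed direction this is the convergence of refractor mappings,
  with a fixed surface it is their continuity.
\<close>

lemma active_tendsto:
  assumes x: "x \<in> E" and le: "\<rho> x \<le> r\<^sub>0" "x \<notin> multi_active \<rho>" and L: "L \<in> K" "active \<kappa> E \<rho> x L"
    and R: "\<And>z. z \<in> E \<Longrightarrow> (\<lambda>n. R n z) \<longlonglongrightarrow> \<rho> z"
    and y: "(\<lambda>n. R n (y n)) \<longlonglongrightarrow> \<rho> x" "y \<longlonglongrightarrow> x"
    and P: "\<And>n. P n \<in> K" "\<And>n. active \<kappa> E (R n) (y n) (P n)"
  shows "P \<longlonglongrightarrow> L"
proof (rule ccontr)
  assume "\<not> P \<longlonglongrightarrow> L"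
  then obtain e where e: "0 < e" "\<not> (\<forall>\<^sub>F n in sequentially. dist (P n) L < e)"
    by (auto simp: tendsto_iff)
  from not_eventually_sequentiallyD[OF e(2)] obtain s :: "nat \<Rightarrow> nat"
    where s: "strict_mono s" "\<And>n. \<not> dist (P (s n)) L < e" by blast
  have "seq_compact K" using K by (rule compact_imp_seq_compact)
  moreover have "\<forall>n. (P \<circ> s) n \<in> K" using P(1) by simp
  ultimately obtain Q t where Q: "Q \<in> K" and t: "strict_mono (t :: nat \<Rightarrow> nat)" and lim: "((P \<circ> s) \<circ> t) \<longlonglongrightarrow> Q"
    by (rule seq_compactE)
  have st: "strict_mono (\<lambda>n. s (t n))"
    using strict_mono_o[OF s(1) t] by (simp add: o_def)
  have sub: "(\<lambda>n. f (s (t n))) \<longlonglongrightarrow> l" if "f \<longlonglongrightarrow> l" for f :: "nat \<Rightarrow> 'z::topological_space" and l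
    using LIMSEQ_subseq_LIMSEQ[OF that st] by (simp add: o_def)
  have "active \<kappa> E \<rho> x Q"
  proof (rule active_limit)
    show "active \<kappa> E (R (s (t n))) (y (s (t n))) (P (s (t n)))" for n by (rule P)
    show "(\<lambda>n. R (s (t n)) z) \<longlonglongrightarrow> \<rho> z" if "z \<in> E" for z using sub[OF R[OF that]] .
    show "(\<lambda>n. R (s (t n)) (y (s (t n)))) \<longlonglongrightarrow> \<rho> x" using sub[OF y(1)] .
    show "(\<lambda>n. y (s (t n))) \<longlonglongrightarrow> x" using sub[OF y(2)] .
    show "(\<lambda>n. P (s (t n))) \<longlonglongrightarrow> Q" using lim by (simp add: o_def)
  qed
  then have "Q = L" using x le L Q unfolding multi_active_def by blast
  moreover have "e \<le> dist Q L"
    by (rule Lim_bounded2[OF tendsto_dist[OF lim tendsto_const], of 0]) (use s(2) in \<open>auto simp: not_less\<close>)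
  ultimately show False using e by simp
qed

lemma refractor_limit:
  assumes ref: "\<And>n. refractor (R n)" and R: "\<And>z. z \<in> E \<Longrightarrow> (\<lambda>n. R n z) \<longlonglongrightarrow> \<rho> z"
    and x0: "x0 \<in> E" "0 < \<rho> x0"
  shows "refractor \<rho>"
  unfolding refractor_def
proof (intro ballI conjI)
  fix y assume y: "y \<in> E"
  have "(1 - \<kappa>) * \<rho> x0 \<le> (1 + \<kappa>) * \<rho> y"
    by (rule LIMSEQ_le[OF tendsto_mult_left[OF R[OF x0(1)]] tendsto_mult_left[OF R[OF y]]])
      (use refractor_harnack[OF ref x0(1) y] in blast)
  moreover have "0 < (1 - \<kappa>) * \<rho> x0" using x0 kappa by simp
  ultimately have "0 < (1 + \<kappa>) * \<rho> y" by simp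
  then show "0 < \<rho> y" using kappa by (simp add: zero_less_mult_iff)
  have "\<forall>n. \<exists>P. P \<in> K \<and> active \<kappa> E (R n) y P" using ref y by (auto simp: refractor_def)
  then obtain P where P: "\<And>n. P n \<in> K" "\<And>n. active \<kappa> E (R n) y (P n)" by metis
  have "seq_compact K" using K by (rule compact_imp_seq_compact)
  moreover have "\<forall>n. P n \<in> K" using P(1) by simp
  ultimately obtain Q t where Q: "Q \<in> K" and t: "strict_mono (t :: nat \<Rightarrow> nat)" and lim: "(P \<circ> t) \<longlonglongrightarrow> Q"
    by (rule seq_compactE)
  have Rt: "(\<lambda>n. R (t n) z) \<longlonglongrightarrow> \<rho> z" if "z \<in> E" for z
    using LIMSEQ_subseq_LIMSEQ[OF R[OF that] t] by (simp add: o_def)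
  have "active \<kappa> E \<rho> y Q"
    by (rule active_limit[where R = "\<lambda>n. R (t n)" and y = "\<lambda>_. y" and P = "P \<circ> t"])
      (use P Rt y lim in auto)
  with Q show "\<exists>P\<in>K. active \<kappa> E \<rho> y P" by blast
qed

text \<open>
  The refractor mapping as a function where it is single-valued on \<open>E\<close>; the value \<open>0\<close>
  elsewhere is arbitrary.
\<close>

definition target :: "(real ^ 'n \<Rightarrow> real) \<Rightarrow> real ^ 'n \<Rightarrow> real ^ 'n" where
  "target \<rho> x = (if x \<in> E - multi_active \<rho> then SOME P. P \<in> K \<and> active \<kappa> E \<rho> x P else 0)"

lemma target:
  assumes "refractor \<rho>" "x \<in> E" "x \<notin> multi_active \<rho>"
  shows "target \<rho> x \<in> K" "active \<kappa> E \<rho> x (target \<rho> x)"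
proof -
  have "\<exists>P. P \<in> K \<and> active \<kappa> E \<rho> x P" using assms by (auto simp: refractor_def)
  from someI_ex[OF this] show "target \<rho> x \<in> K" "active \<kappa> E \<rho> x (target \<rho> x)"
    using assms by (auto simp: target_def)
qed

lemma target_measurable:
  assumes ref: "refractor \<rho>" and le: "\<And>x. x \<in> E \<Longrightarrow> \<rho> x \<le> r\<^sub>0"
  shows "target \<rho> \<in> borel_measurable borel"
proof -
  let ?A = "E - multi_active \<rho>"
  have A: "?A \<in> sets borel"
    using E(1) multi_active_borel[OF refractor_continuous[OF ref]]
    by (intro sets.Diff) (auto intro: borel_closed compact_imp_closed)
  have cont: "continuous_on ?A (target \<rho>)"
    unfolding continuous_on_sequentially
  proof (intro allI ballI impI, elim conjE)
    fix y x assume x: "x \<in> ?A" and y: "\<forall>n. y n \<in> ?A" "y \<longlonglongrightarrow> x"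
    have "(\<lambda>n. \<rho> (y n)) \<longlonglongrightarrow> \<rho> x"
      using continuous_on_tendsto_compose[OF refractor_continuous[OF ref] y(2)] x y(1) by auto
    then have "(\<lambda>n. target \<rho> (y n)) \<longlonglongrightarrow> target \<rho> x"
      by (rule active_tendsto[where R = "\<lambda>_. \<rho>" and y = y and \<rho> = \<rho> and x = x, rotated 6])
        (use x y target[OF ref] le in auto)
    then show "(target \<rho> \<circ> y) \<longlonglongrightarrow> target \<rho> x" by (simp add: o_def)
  qed
  have "(\<lambda>x. if x \<in> ?A then target \<rho> x else 0) \<in> borel_measurable borel"
    by (rule borel_measurable_continuous_on_if[OF A cont continuous_on_const])
  moreover have "(\<lambda>x. if x \<in> ?A then target \<rho> x else 0) = target \<rho>"
    by (auto simp: target_def)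
  ultimately show ?thesis by simp
qed

end

text \<open>
  Approximating simple functions are projected to \<open>K\<close>, which at most doubles their distance to a point of
  \<open>K\<close>.
\<close>

lemma finite_valued_approximations:
  fixes K :: "'a::euclidean_space set"
  assumes \<mu>: "sets \<mu> = sets borel" and K: "closed K" "K \<noteq> {}"
  obtains q :: "nat \<Rightarrow> 'a \<Rightarrow> 'a" where "\<And>n. simple_function \<mu> (q n)" "\<And>n P. q n P \<in> K"
    "\<And>P. P \<in> K \<Longrightarrow> (\<lambda>n. q n P) \<longlonglongrightarrow> P"
proof -
  have sp: "space \<mu> = UNIV" using sets_eq_imp_space_eq[OF \<mu>] by simp
  have "(\<lambda>P. P) \<in> borel_measurable \<mu>" by (simp add: measurable_cong_sets[OF \<mu>])
  from borel_measurable_implies_sequence_metric[OF this, of undefined] obtain F where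
    F: "\<And>n. simple_function \<mu> (F n)" "\<And>P. (\<lambda>n. F n P) \<longlonglongrightarrow> P"
    unfolding sp by blast
  show thesis
  proof
    show "simple_function \<mu> (\<lambda>P. closest_point K (F n P))" for n
      by (rule simple_function_compose1[OF F(1)])
    show "closest_point K (F n P) \<in> K" for n P by (rule closest_point_in_set[OF K])
    show "(\<lambda>n. closest_point K (F n P)) \<longlonglongrightarrow> P" if "P \<in> K" for P
    proof -
      have "dist (closest_point K (F n P)) P \<le> 2 * dist (F n P) P" for n
        using closest_point_le[OF K(1) that, of "F n P"] dist_triangle3[of "closest_point K (F n P)" P "F n P"]
        by simp
      then have bound: "\<forall>\<^sub>F n in sequentially. norm (dist (closest_point K (F n P)) P) \<le> 2 * dist (F n P) P"
        by (intro always_eventually allI) simp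
      have "(\<lambda>n. dist (F n P) P) \<longlonglongrightarrow> 0"
        by (rule tendsto_dist_iff[THEN iffD1, OF F(2)])
      then have "(\<lambda>n. 2 * dist (F n P) P) \<longlonglongrightarrow> 0"
        by (rule tendsto_mult_right_zero)
      with bound have "(\<lambda>n. dist (closest_point K (F n P)) P) \<longlonglongrightarrow> 0"
        by (rule Lim_null_comparison)
      then show ?thesis by (rule tendsto_dist_iff[THEN iffD2])
    qed
  qed
qed

context illuminated
begin

text \<open>
  The targets are the finitely many values of \<open>q n\<close>, weighted by their share of \<open>\<mu>\<close>. For
  a bounded continuous \<open>g\<close> the sum of \<open>g\<close> over these targets, weighted by the masses of
  their cells, is the integral over \<open>\<nu>\<close> of \<open>g\<close> at the active target. It converges on one
  side to the integral of \<open>g\<close> over the push-forward of \<open>\<nu>\<close> by the limiting refractor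
  mapping, and on the other side to the integral of \<open>g\<close> over \<open>\<mu>\<close>.
\<close>

theorem exists_refractor:
  assumes \<mu>: "finite_measure \<mu>" "sets \<mu> = sets borel" "AE P in \<mu>. P \<in> K" "measure \<mu> UNIV = measure \<nu> UNIV"
    and x0: "x0 \<in> E" and a: "0 < a" "(1 + \<kappa>) * a < (1 - \<kappa>) * r\<^sub>0"
  obtains \<rho> where "refractor \<rho>" "\<And>x. x \<in> E \<Longrightarrow> \<rho> x \<le> r\<^sub>0" "\<rho> x0 = a" "distr \<nu> borel (target \<rho>) = \<mu>"
proof -
  interpret \<mu>: finite_measure \<mu> by (rule \<mu>)
  have sp: "space \<mu> = UNIV" using sets_eq_imp_space_eq[OF \<mu>(2)] by simp
  have "0 < measure \<nu> (ball x0 1)" by (rule pos[OF x0]) simp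
  also have "\<dots> \<le> measure \<nu> UNIV" by (rule finite_measure_mono) (auto simp: sets_nu)
  finally have tot: "0 < measure \<mu> UNIV" using \<mu>(4) by simp
  have "K \<noteq> {}"
  proof
    assume "K = {}"
    then have "AE P in \<mu>. P \<notin> UNIV" using \<mu>(3) by simp
    then have "emeasure \<mu> UNIV = 0"
      using \<mu>.emeasure_eq_measure sp by (subst (asm) AE_iff_measurable[of UNIV]) (auto simp: \<mu>(2))
    then show False using tot by (simp add: measure_def)
  qed
  then obtain q where q: "\<And>n. simple_function \<mu> (q n)" "\<And>n P. q n P \<in> K" "\<And>P. P \<in> K \<Longrightarrow> (\<lambda>n. q n P) \<longlonglongrightarrow> P"
    using finite_valued_approximations[OF \<mu>(2)] compact_imp_closed[OF K] by metis
  define I where "I n = range (q n)" for n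
  have I: "finite (I n)" "I n \<noteq> {}" "I n \<subseteq> K" for n
    using simple_functionD(1)[OF q(1)[of n]] q(2) by (auto simp: I_def sp)
  define w where "w n P = measure \<mu> (q n -` {P})" for n P
  have q_sets: "q n -` {P} \<in> sets \<mu>" for n P
    using simple_functionD(2)[OF q(1)[of n], of "{P}"] by (simp add: sp)
  have int_q: "(\<integral>P. g (q n P) \<partial>\<mu>) = (\<Sum>P\<in>I n. g P * w n P)" for g :: "real ^ 'n \<Rightarrow> real" and n
  proof -
    have "(\<integral>P. g (q n P) \<partial>\<mu>) = (\<integral>P. (\<Sum>Q\<in>I n. g Q * indicator (q n -` {Q}) P) \<partial>\<mu>)"
    proof (rule Bochner_Integration.integral_cong[OF refl])
      fix P
      have "(\<Sum>Q\<in>I n. g Q * indicator (q n -` {Q}) P) = (\<Sum>Q\<in>I n. if Q = q n P then g Q else 0)"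
        by (intro sum.cong) (auto split: split_indicator)
      also have "\<dots> = g (q n P)" using I(1)[of n] by (simp add: I_def)
      finally show "g (q n P) = (\<Sum>Q\<in>I n. g Q * indicator (q n -` {Q}) P)" by simp
    qed
    also have "\<dots> = (\<Sum>Q\<in>I n. \<integral>P. g Q * indicator (q n -` {Q}) P \<partial>\<mu>)"
      using q_sets by (intro Bochner_Integration.integral_sum integrable_mult_right integrable_real_indicator)
        (auto simp: less_top[symmetric])
    also have "\<dots> = (\<Sum>P\<in>I n. g P * w n P)" by (simp add: w_def sp)
    finally show ?thesis .
  qed
  have w: "sum (w n) (I n) = measure \<nu> UNIV" for n
    using int_q[of "\<lambda>_. 1" n] \<mu>(4) by (simp add: sp)
  define \<epsilon> where "\<epsilon> n = 1 / real (Suc n)" for n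
  have \<epsilon>: "0 < \<epsilon> n" for n by (simp add: \<epsilon>_def)
  have \<epsilon>_lim: "\<epsilon> \<longlonglongrightarrow> 0"
    using LIMSEQ_inverse_real_of_nat by (simp add: \<epsilon>_def[abs_def] inverse_eq_divide)
  have "\<forall>n. \<exists>b. (\<forall>P\<in>I n. \<kappa> * norm P < b P) \<and> \<bar>envelope \<kappa> (I n) b x0 - a\<bar> \<le> \<epsilon> n \<and>
      (\<forall>x\<in>E. envelope \<kappa> (I n) b x < r\<^sub>0) \<and> (\<Sum>P\<in>I n. \<bar>measure \<nu> (cell \<kappa> (I n) b P) - w n P\<bar>) \<le> \<epsilon> n"
  proof
    fix n
    obtain b where "\<And>P. P \<in> I n \<Longrightarrow> \<kappa> * norm P < b P" "\<bar>envelope \<kappa> (I n) b x0 - a\<bar> \<le> \<epsilon> n"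
      "\<And>x. x \<in> E \<Longrightarrow> envelope \<kappa> (I n) b x < r\<^sub>0"
      "(\<Sum>P\<in>I n. \<bar>measure \<nu> (cell \<kappa> (I n) b P) - w n P\<bar>) \<le> \<epsilon> n"
      by (rule exists_discrete_refractor[OF x0 a \<epsilon>[of n] I[of n] _ w[of n]]) (simp add: w_def, blast)
    then show "\<exists>b. (\<forall>P\<in>I n. \<kappa> * norm P < b P) \<and> \<bar>envelope \<kappa> (I n) b x0 - a\<bar> \<le> \<epsilon> n \<and>
      (\<forall>x\<in>E. envelope \<kappa> (I n) b x < r\<^sub>0) \<and> (\<Sum>P\<in>I n. \<bar>measure \<nu> (cell \<kappa> (I n) b P) - w n P\<bar>) \<le> \<epsilon> n"
      by (intro exI[of _ b] conjI ballI)
  qed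
  from choice[OF this] obtain b where all: "\<forall>n. (\<forall>P\<in>I n. \<kappa> * norm P < b n P) \<and>
      \<bar>envelope \<kappa> (I n) (b n) x0 - a\<bar> \<le> \<epsilon> n \<and> (\<forall>x\<in>E. envelope \<kappa> (I n) (b n) x < r\<^sub>0) \<and>
      (\<Sum>P\<in>I n. \<bar>measure \<nu> (cell \<kappa> (I n) (b n) P) - w n P\<bar>) \<le> \<epsilon> n" ..
  have b: "\<kappa> * norm P < b n P" if "P \<in> I n" for n P
    using all that by blast
  have bx0: "\<bar>envelope \<kappa> (I n) (b n) x0 - a\<bar> \<le> \<epsilon> n" for n
    using all by blast
  have below: "envelope \<kappa> (I n) (b n) x < r\<^sub>0" if "x \<in> E" for n x
    using all that by blast
  have err: "(\<Sum>P\<in>I n. \<bar>measure \<nu> (cell \<kappa> (I n) (b n) P) - w n P\<bar>) \<le> \<epsilon> n" for n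
    using all by blast
  define u where "u n = envelope \<kappa> (I n) (b n)" for n
  have u_ref: "refractor (u n)" for n
    unfolding u_def by (rule envelope_refractor[OF I b])
  have u_bd: "0 < u n x" "u n x < r\<^sub>0" if "x \<in> E" for n x
    using u_ref[of n] below[OF that, of n] that by (auto simp: refractor_def u_def)
  define L where "L = \<kappa> * r\<^sub>0 / (1 - \<kappa>) + 1"
  have L: "0 < L" using kappa r0 by (simp add: L_def add_nonneg_pos)
  have u_lip: "norm (u n x - u n y) \<le> L * norm (x - y)" if "x \<in> E" "y \<in> E" for n x y
  proof -
    have "(1 - \<kappa>) * \<bar>u n x - u n y\<bar> \<le> \<kappa> * u n y * norm (x - y)"
      by (rule refractor_lipschitz[OF u_ref that])
    also have "\<dots> \<le> \<kappa> * r\<^sub>0 * norm (x - y)"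
      using u_bd[OF that(2), of n] kappa by (intro mult_right_mono mult_left_mono) auto
    finally have "\<bar>u n x - u n y\<bar> \<le> \<kappa> * r\<^sub>0 / (1 - \<kappa>) * norm (x - y)"
      using kappa by (simp add: field_simps)
    also have "\<dots> \<le> L * norm (x - y)" by (intro mult_right_mono) (auto simp: L_def)
    finally show ?thesis by simp
  qed
  have norm_u: "norm (u n x) \<le> r\<^sub>0" if "x \<in> E" for n x
    using u_bd[OF that, of n] by simp
  have equi: "\<exists>d. 0 < d \<and> (\<forall>n y. y \<in> E \<and> norm (x - y) < d \<longrightarrow> norm (u n x - u n y) < e)"
    if "x \<in> E" "0 < e" for x e
  proof (intro exI[of _ "e / L"] conjI allI impI)
    show "0 < e / L" using that L by simp
    fix n y assume y: "y \<in> E \<and> norm (x - y) < e / L"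
    have "norm (u n x - u n y) \<le> L * norm (x - y)" using u_lip that y by blast
    also have "\<dots> < e" using y L by (simp add: pos_less_divide_eq mult.commute)
    finally show "norm (u n x - u n y) < e" .
  qed
  have "\<exists>\<rho> k. strict_mono (k :: nat \<Rightarrow> nat) \<and>
      (\<forall>e>0. \<exists>N. \<forall>n x. n \<ge> N \<and> x \<in> E \<longrightarrow> norm (u (k n) x - \<rho> x) < e)"
  proof (rule Arzela_Ascoli[OF E(1) norm_u equi])
    fix g and k :: "nat \<Rightarrow> nat"
    assume "strict_mono k" "\<And>e. 0 < e \<Longrightarrow> \<exists>N. \<forall>n x. n \<ge> N \<and> x \<in> E \<longrightarrow> norm (u (k n) x - g x) < e"
    then show ?thesis by blast
  qed
  then obtain \<rho> k where k: "strict_mono (k :: nat \<Rightarrow> nat)"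
    and unif: "\<And>e. 0 < e \<Longrightarrow> \<exists>N. \<forall>n x. n \<ge> N \<and> x \<in> E \<longrightarrow> norm (u (k n) x - \<rho> x) < e"
    by blast
  have lim: "(\<lambda>n. u (k n) x) \<longlonglongrightarrow> \<rho> x" if "x \<in> E" for x
    unfolding LIMSEQ_iff using unif that by blast
  have \<epsilon>k: "(\<lambda>n. \<epsilon> (k n)) \<longlonglongrightarrow> 0"
    using LIMSEQ_subseq_LIMSEQ[OF \<epsilon>_lim k] by (simp add: o_def)
  have "(\<lambda>n. u (k n) x0 - a) \<longlonglongrightarrow> 0"
    by (rule Lim_null_comparison[OF _ \<epsilon>k]) (use bx0 in \<open>auto simp: u_def\<close>)
  then have "(\<lambda>n. u (k n) x0) \<longlonglongrightarrow> a" by (simp add: LIM_zero_iff)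
  then have \<rho>x0: "\<rho> x0 = a" using LIMSEQ_unique lim[OF x0] by blast
  have ref: "refractor \<rho>"
    by (rule refractor_limit[OF u_ref lim x0]) (use \<rho>x0 a in auto)
  have \<rho>_le: "\<rho> x \<le> r\<^sub>0" if "x \<in> E" for x
    by (rule Lim_bounded[OF lim[OF that], of 0]) (use u_bd[OF that] in \<open>auto intro: less_imp_le\<close>)
  have T_meas: "target \<rho> \<in> borel_measurable \<nu>"
    using target_measurable[OF ref \<rho>_le] by (simp add: measurable_cong_sets[OF sets_nu])
  have "distr \<nu> borel (target \<rho>) = \<mu>"
  proof (rule finite_borel_measure_eqI)
    show "finite_measure (distr \<nu> borel (target \<rho>))"
      by (rule finite_measure_distr[OF T_meas])
    fix g :: "real ^ 'n \<Rightarrow> real" assume cont: "continuous_on UNIV g" and g01: "\<And>x. 0 \<le> g x \<and> g x \<le> 1"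
    have g_meas: "g \<in> borel_measurable borel" by (rule borel_measurable_continuous_onI[OF cont])
    define H where "H n x = (\<Sum>P\<in>I n. g P * indicator (cell \<kappa> (I n) (b n) P) x)" for n x
    have cell_sets: "cell \<kappa> (I n) (b n) P \<in> sets \<nu>" for n P
      unfolding sets_nu by (rule borel_closed[OF closed_cell])
    have H_meas: "H n \<in> borel_measurable \<nu>" for n
      unfolding H_def[abs_def] using cell_sets by (intro borel_measurable_sum borel_measurable_times) auto
    have uniq: "AE x in \<nu>. \<forall>n. \<exists>P. P \<in> I n \<and> x \<in> cell \<kappa> (I n) (b n) P \<and> H n x = g P"
      unfolding AE_all_countable
    proof
      fix n
      have "AE x in \<nu>. x \<in> E \<and> (envelope \<kappa> (I n) (b n) x \<le> r\<^sub>0 \<longrightarrow> (\<exists>!P. P \<in> I n \<and> x \<in> cell \<kappa> (I n) (b n) P))"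
        by (rule AE_unique_cell[OF I b])
      then show "AE x in \<nu>. \<exists>P. P \<in> I n \<and> x \<in> cell \<kappa> (I n) (b n) P \<and> H n x = g P"
      proof eventually_elim
        case (elim x)
        then have "\<exists>!P. P \<in> I n \<and> x \<in> cell \<kappa> (I n) (b n) P"
          using below[of x n] by auto
        then obtain P where P: "P \<in> I n \<and> x \<in> cell \<kappa> (I n) (b n) P"
          and u: "\<forall>Q. Q \<in> I n \<and> x \<in> cell \<kappa> (I n) (b n) Q \<longrightarrow> Q = P" by (rule ex1E)
        have "H n x = g P * indicator (cell \<kappa> (I n) (b n) P) x +
            (\<Sum>Q\<in>I n - {P}. g Q * indicator (cell \<kappa> (I n) (b n) Q) x)"
          unfolding H_def using P I(1) by (intro sum.remove) auto
        also have "(\<Sum>Q\<in>I n - {P}. g Q * indicator (cell \<kappa> (I n) (b n) Q) x) = 0"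
        proof (rule sum.neutral, rule ballI)
          fix Q assume "Q \<in> I n - {P}"
          then have "x \<notin> cell \<kappa> (I n) (b n) Q" using u by blast
          then show "g Q * indicator (cell \<kappa> (I n) (b n) Q) x = 0" by simp
        qed
        finally show ?case using P by (intro exI[of _ P]) simp
      qed
    qed
    have conv: "AE x in \<nu>. (\<lambda>n. H (k n) x) \<longlonglongrightarrow> g (target \<rho> x)"
      using uniq AE_E AE_not_in[OF multi_active_null[OF ref]]
    proof eventually_elim
      case (elim x)
      then obtain P where P: "\<And>n. P n \<in> I n" "\<And>n. x \<in> cell \<kappa> (I n) (b n) (P n)" "\<And>n. H n x = g (P n)"
        by metis
      have act: "active \<kappa> E (u n) x (P n)" for n
        unfolding u_def by (rule cell_imp_active[OF I b]) (use elim P in auto)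
      have PK: "P n \<in> K" for n using P(1) I(3) by blast
      have "(\<lambda>n. P (k n)) \<longlonglongrightarrow> target \<rho> x"
        by (rule active_tendsto[where R = "\<lambda>n. u (k n)" and y = "\<lambda>_. x" and \<rho> = \<rho> and x = x])
          (use elim lim target[OF ref] \<rho>_le act PK in auto)
      then have "(\<lambda>n. g (P (k n))) \<longlonglongrightarrow> g (target \<rho> x)"
        by (intro continuous_on_tendsto_compose[OF cont]) auto
      then show ?case by (simp add: P(3))
    qed
    have H_bd: "AE x in \<nu>. norm (H n x) \<le> 1" for n
      using uniq
    proof eventually_elim
      case (elim x)
      then obtain P where "H n x = g P" by blast
      then show ?case using g01[of P] by simp
    qed
    have int1: "(\<lambda>n. \<integral>x. H (k n) x \<partial>\<nu>) \<longlonglongrightarrow> (\<integral>x. g (target \<rho> x) \<partial>\<nu>)"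
      by (rule integral_dominated_convergence[where w = "\<lambda>_. 1"])
        (use H_meas measurable_compose[OF T_meas g_meas] conv H_bd in auto)
    have int_H: "(\<integral>x. H n x \<partial>\<nu>) = (\<Sum>P\<in>I n. g P * measure \<nu> (cell \<kappa> (I n) (b n) P))" for n
    proof -
      have "(\<integral>x. H n x \<partial>\<nu>) = (\<Sum>P\<in>I n. \<integral>x. g P * indicator (cell \<kappa> (I n) (b n) P) x \<partial>\<nu>)"
        unfolding H_def using cell_sets
        by (intro Bochner_Integration.integral_sum integrable_mult_right integrable_real_indicator)
          (auto simp: less_top[symmetric])
      then show ?thesis by (simp add: space_nu)
    qed
    have close: "norm ((\<integral>x. H n x \<partial>\<nu>) - (\<integral>P. g (q n P) \<partial>\<mu>)) \<le> \<epsilon> n" for n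
    proof -
      have "(\<integral>x. H n x \<partial>\<nu>) - (\<integral>P. g (q n P) \<partial>\<mu>) =
          (\<Sum>P\<in>I n. g P * (measure \<nu> (cell \<kappa> (I n) (b n) P) - w n P))"
        unfolding int_H int_q by (simp add: sum_subtractf right_diff_distrib)
      also have "norm \<dots> \<le> (\<Sum>P\<in>I n. norm (g P * (measure \<nu> (cell \<kappa> (I n) (b n) P) - w n P)))"
        by (rule norm_sum)
      also have "\<dots> \<le> (\<Sum>P\<in>I n. \<bar>measure \<nu> (cell \<kappa> (I n) (b n) P) - w n P\<bar>)"
        using g01 by (intro sum_mono) (auto simp: abs_mult intro: mult_left_le_one_le)
      also have "\<dots> \<le> \<epsilon> n" by (rule err)
      finally show ?thesis .
    qed
    have int2: "(\<lambda>n. \<integral>P. g (q (k n) P) \<partial>\<mu>) \<longlonglongrightarrow> (\<integral>P. g P \<partial>\<mu>)"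
    proof (rule integral_dominated_convergence[where w = "\<lambda>_. 1"])
      show "g \<in> borel_measurable \<mu>" using g_meas by (simp add: measurable_cong_sets[OF \<mu>(2)])
      show "(\<lambda>P. g (q (k n) P)) \<in> borel_measurable \<mu>" for n
        using borel_measurable_simple_function[OF simple_function_compose1[OF q(1)]] .
      show "AE P in \<mu>. (\<lambda>n. g (q (k n) P)) \<longlonglongrightarrow> g P"
        using \<mu>(3)
      proof eventually_elim
        case (elim P)
        have "(\<lambda>n. q (k n) P) \<longlonglongrightarrow> P"
          using LIMSEQ_subseq_LIMSEQ[OF q(3)[OF elim] k] by (simp add: o_def)
        then show ?case by (intro continuous_on_tendsto_compose[OF cont]) auto
      qed
    qed (use g01 in auto)
    have "(\<lambda>n. (\<integral>x. H (k n) x \<partial>\<nu>) - (\<integral>P. g (q (k n) P) \<partial>\<mu>)) \<longlonglongrightarrow> 0"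
      by (rule Lim_null_comparison[OF _ \<epsilon>k]) (use close in auto)
    moreover have "(\<lambda>n. (\<integral>x. H (k n) x \<partial>\<nu>) - (\<integral>P. g (q (k n) P) \<partial>\<mu>)) \<longlonglongrightarrow>
        (\<integral>x. g (target \<rho> x) \<partial>\<nu>) - (\<integral>P. g P \<partial>\<mu>)"
      by (rule tendsto_diff[OF int1 int2])
    ultimately have "(\<integral>x. g (target \<rho> x) \<partial>\<nu>) = (\<integral>P. g P \<partial>\<mu>)"
      using LIMSEQ_unique by fastforce
    then show "(\<integral>x. g x \<partial>distr \<nu> borel (target \<rho>)) = (\<integral>P. g P \<partial>\<mu>)"
      by (simp add: integral_distr[OF T_meas g_meas])
  qed (use \<mu> in auto)
  with ref \<rho>_le \<rho>x0 show thesis by (rule that)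
qed

end

section \<open>Surface measure and the weak solution\<close>

lemma complete_sphere_measure: "complete_measure (sphere_measure :: (real ^ 'n) measure)"
  unfolding sphere_measure_def by (rule completion.complete_measure_axioms)

lemma borel_sphere_sets: "A \<in> sets borel \<Longrightarrow> A \<inter> sphere 0 1 \<in> sets sphere_measure"
  by (rule emeasure_sphere_measure(1)) auto

lemma null_sets_sphere_measure_if_negligible_cone:
  assumes "N \<in> sets borel" "N \<subseteq> sphere 0 1" "negligible {t *\<^sub>R x | t x. x \<in> N \<and> 0 < t \<and> t \<le> 1}"
  shows "N \<in> null_sets sphere_measure"
proof -
  let ?C = "{t *\<^sub>R x | t x. x \<in> N \<and> 0 < t \<and> t \<le> 1}"
  have "emeasure lborel ?C = 0"
  proof (cases "?C \<in> sets lborel")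
    case True
    have "?C \<in> null_sets lebesgue" using assms(3) by (simp add: negligible_iff_null_sets)
    then show ?thesis using True by (simp add: null_sets_completion_iff null_setsD1)
  qed (rule emeasure_notin_sets)
  then show ?thesis
    using emeasure_sphere_measure[OF assms(1,2)] by (simp add: null_setsI)
qed

text \<open>
  The cone over a nonempty relatively open set contains a nonempty open set.
\<close>

lemma openin_sphere_not_null:
  fixes U :: "(real ^ 'n) set"
  assumes U: "openin (top_of_set (sphere 0 1)) U" "U \<noteq> {}"
  shows "U \<notin> null_sets sphere_measure"
proof
  assume null: "U \<in> null_sets sphere_measure"
  obtain V where V: "open V" "U = sphere 0 1 \<inter> V"
    using U(1) by (auto simp: openin_open)
  let ?C = "{t *\<^sub>R x | t x. x \<in> U \<and> 0 < t \<and> t \<le> 1}"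
  let ?O = "- {0} \<inter> sgn -` V"
  have "open ?O"
    by (rule continuous_open_preimage[OF continuous_on_sgn[OF continuous_on_id]]) (use V in auto)
  have C_eq: "?C = ?O \<inter> cball 0 1"
  proof (intro equalityI subsetI)
    fix z assume "z \<in> ?C"
    then obtain t x where "z = t *\<^sub>R x" "x \<in> U" "0 < t" "t \<le> 1" by blast
    moreover from this have "norm x = 1" using V by auto
    ultimately show "z \<in> ?O \<inter> cball 0 1"
      using V by (auto simp: sgn_div_norm)
  next
    fix z assume z: "z \<in> ?O \<inter> cball 0 1"
    then have "z = norm z *\<^sub>R sgn z" "sgn z \<in> U" "0 < norm z" "norm z \<le> 1"
      using V by (auto simp: sgn_div_norm norm_sgn)
    then show "z \<in> ?C" by blast
  qed
  have "U \<in> sets borel" using V by (auto intro!: sets.Int)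
  then have "of_nat CARD('n) * emeasure lborel ?C = 0"
    using emeasure_sphere_measure(2)[of U] V null by (auto simp: null_sets_def)
  then have "emeasure lborel ?C = 0" by simp
  moreover have "?C \<in> sets lborel"
    unfolding C_eq using \<open>open ?O\<close> by auto
  ultimately have "?C \<in> null_sets lborel" by (simp add: null_setsI)
  then have "negligible ?C"
    by (simp add: negligible_iff_null_sets null_sets_completionI)
  moreover have "?O \<inter> ball 0 1 \<subseteq> ?C" unfolding C_eq by auto
  ultimately have "negligible (?O \<inter> ball 0 1)" by (rule negligible_subset)
  moreover have "?O \<inter> ball 0 1 \<noteq> {}"
  proof -
    obtain x where x: "x \<in> U" using U(2) by blast
    then have n: "norm x = 1" "x \<in> V" using V by auto
    then have "(1/2) *\<^sub>R x \<in> ?O \<inter> ball 0 1"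
      by (auto simp: sgn_div_norm)
    then show ?thesis by blast
  qed
  moreover have "open (?O \<inter> ball 0 1)" using \<open>open ?O\<close> by auto
  ultimately show False using open_not_negligible by blast
qed

text \<open>
  Used for the intensity \<open>f\<close>, about which nothing is known on the boundary of \<open>\<Omega>\<close>.
\<close>

lemma (in complete_measure) borel_measurable_if_AE_eq:
  fixes f g :: "'a \<Rightarrow> 'b::topological_space"
  assumes f: "f \<in> borel_measurable M" and ae: "AE x in M. f x = g x"
  shows "g \<in> borel_measurable M"
proof (rule measurableI)
  fix Y :: "'b set" assume "Y \<in> sets borel"
  then have sets: "f -` Y \<inter> space M \<in> sets M" using f by (rule measurable_sets[rotated])
  have "AE x in M. x \<in> f -` Y \<inter> space M \<longleftrightarrow> x \<in> g -` Y \<inter> space M"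
    using ae by eventually_elim auto
  from in_sets_AE[OF this sets] show "g -` Y \<inter> space M \<in> sets M" by simp
qed simp

theorem theorem5p8:
  fixes \<Omega> D :: "(real ^ 'n) set"
    and \<kappa> \<tau> r\<^sub>0 :: real
    and \<mu> :: "(real ^ 'n) measure"
    and f :: "real ^ 'n \<Rightarrow> real"
    and X\<^sub>0 :: "real ^ 'n"
  assumes "CARD('n) \<ge> 2"
    and "0 < \<kappa>" and "\<kappa> < 1"
    and "openin (top_of_set (sphere 0 1)) \<Omega>" and "connected \<Omega>" and "\<Omega> \<noteq> {}"
    and "top_of_set (sphere 0 1) frontier_of \<Omega> \<in> null_sets sphere_measure"
    and "\<exists>\<Sigma>. hypersurface \<Sigma> \<and> D \<subseteq> \<Sigma>"
    and "compact (closure D)" and "0 \<notin> closure D"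
    and H1: "0 < \<tau>" "\<tau> < 1 - \<kappa>"
      "\<forall>x \<in> closure \<Omega>. \<forall>P \<in> closure D. x \<bullet> P \<ge> (\<kappa> + \<tau>) * norm P"
    and H2: "0 < r\<^sub>0" "r\<^sub>0 \<le> \<tau> / (1 + \<kappa>) * infdist 0 (closure D)"
      "\<forall>m \<in> sphere 0 1. \<forall>X \<in> cone_region \<Omega> r\<^sub>0.
         \<forall>P \<in> closure D \<inter> {X + t *\<^sub>R m | t. t \<ge> 0}.
         \<forall>P' \<in> closure D \<inter> {X + t *\<^sub>R m | t. t \<ge> 0}. P = P'"
    and "radon_measure_on (closure D) \<mu>"
    and "set_integrable sphere_measure \<Omega> f"
    and "AE x in sphere_measure. x \<in> \<Omega> \<longrightarrow> 0 < f x"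
    and "(LINT x:\<Omega>|sphere_measure. f x) = measure \<mu> (closure D)"
    and "X\<^sub>0 \<in> cone_region \<Omega> r\<^sub>0" and "0 < norm X\<^sub>0"
    and "norm X\<^sub>0 < ((1 - \<kappa>) / (1 + \<kappa>)) ^ 3 * r\<^sub>0"
  shows "\<exists>\<rho>. weak_solution \<kappa> \<Omega> D r\<^sub>0 f \<mu> \<rho> \<and> X\<^sub>0 \<in> radial_surface \<Omega> \<rho>"
proof -
  note kappa = assms(2,3) and \<Omega>_open = assms(4) and front = assms(7)
    and K_compact = assms(9) and \<mu>_radon = assms(17) and f_int = assms(18) and f_pos = assms(19)
    and balance = assms(20) and X0 = assms(21,22,23)
  define E where "E = closure \<Omega>"
  define K where "K = closure D"
  have \<Omega>_sphere: "\<Omega> \<subseteq> sphere 0 1"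
    using openin_imp_subset[OF \<Omega>_open] by simp
  have E_sphere: "E \<subseteq> sphere 0 1"
    unfolding E_def by (rule closure_minimal[OF \<Omega>_sphere]) simp
  have "compact E"
    unfolding E_def compact_closure using \<Omega>_sphere bounded_subset bounded_sphere by blast
  have \<Omega>_E: "\<Omega> \<subseteq> E" unfolding E_def by (rule closure_subset)
  interpret near_field \<kappa> \<tau> r\<^sub>0 E K
  proof
    show "(1 + \<kappa>) * r\<^sub>0 \<le> \<tau> * norm P" if "P \<in> K" for P
    proof -
      have "infdist 0 K \<le> norm P" using infdist_le[OF that, of 0] by simp
      then have "\<tau> / (1 + \<kappa>) * infdist 0 K \<le> \<tau> / (1 + \<kappa>) * norm P"
        using H1 kappa by (intro mult_left_mono) auto
      with H2(2) have "r\<^sub>0 \<le> \<tau> / (1 + \<kappa>) * norm P" by (simp add: K_def)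
      then show ?thesis using kappa by (simp add: field_simps)
    qed
    show "r *\<^sub>R x + t *\<^sub>R m = r *\<^sub>R x + t' *\<^sub>R m"
      if "x \<in> E" "0 < r" "r \<le> r\<^sub>0" "norm m = 1" "0 \<le> t" "0 \<le> t'"
        "r *\<^sub>R x + t *\<^sub>R m \<in> K" "r *\<^sub>R x + t' *\<^sub>R m \<in> K" for x r m t t'
    proof -
      have "m \<in> sphere 0 1" using that by simp
      moreover have "r *\<^sub>R x \<in> cone_region \<Omega> r\<^sub>0" using that by (auto simp: cone_region_def E_def)
      moreover have "r *\<^sub>R x + t *\<^sub>R m \<in> closure D \<inter> {r *\<^sub>R x + t *\<^sub>R m | t. t \<ge> 0}"
        "r *\<^sub>R x + t' *\<^sub>R m \<in> closure D \<inter> {r *\<^sub>R x + t *\<^sub>R m | t. t \<ge> 0}"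
        using that by (auto simp: K_def)
      ultimately show ?thesis using H2(3) by blast
    qed
  qed (use kappa \<open>compact E\<close> E_sphere K_compact H1 H2(1) in \<open>auto simp: E_def K_def\<close>)
  let ?S = "sphere_measure :: (real ^ 'n) measure"
  interpret S: complete_measure ?S by (rule complete_sphere_measure)
  have "E - \<Omega> \<in> null_sets ?S"
  proof -
    have "top_of_set (sphere 0 1) frontier_of \<Omega> = E - \<Omega>"
      unfolding frontier_of_def interior_of_openin[OF \<Omega>_open] closure_of_subtopology
      using \<Omega>_sphere E_sphere by (auto simp: E_def Int_absorb1)
    with front show ?thesis by simp
  qed
  then have AE_\<Omega>: "AE x in ?S. x \<in> E \<longrightarrow> x \<in> \<Omega>"
    using AE_not_in by fastforce
  \<comment> \<open>On the closure of \<open>\<Omega>\<close> this differs from \<open>f\<close> only on the boundary, a null set.\<close>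
  define h where "h x = indicator \<Omega> x * f x" for x
  have h_int: "integrable ?S h"
    using f_int by (simp add: h_def[abs_def] set_integrable_def)
  have h_nonneg: "AE x in ?S. 0 \<le> h x"
    using f_pos by eventually_elim (auto simp: h_def split: split_indicator)
  have ind_nonneg: "AE x in ?S. 0 \<le> indicator A x * h x" for A
    using h_nonneg by eventually_elim (simp split: split_indicator)
  define \<nu> where "\<nu> = distr (density ?S (\<lambda>x. ennreal (h x))) borel (\<lambda>x. x)"
  have sets_\<nu>: "sets \<nu> = sets borel" by (simp add: \<nu>_def)
  have id_meas: "(\<lambda>x. x) \<in> density ?S (\<lambda>x. ennreal (h x)) \<rightarrow>\<^sub>M borel"
    by (rule measurableI) (auto dest: borel_sphere_sets)
  have ind_int: "integrable ?S (\<lambda>x. indicator A x * h x)" if "A \<in> sets borel" for A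
  proof -
    have "integrable ?S (\<lambda>x. indicator (A \<inter> sphere 0 1) x * h x)"
      using borel_sphere_sets[OF that] h_int by (rule integrable_mult_indicator[where 'b = real, simplified])
    moreover have "indicator (A \<inter> sphere 0 1) x * h x = indicator A x * h x" for x
      using \<Omega>_sphere by (auto simp: h_def split: split_indicator)
    ultimately show ?thesis by simp
  qed
  have em_\<nu>: "emeasure \<nu> A = ennreal (\<integral>x. indicator A x * h x \<partial>?S)" if A: "A \<in> sets borel" for A
  proof -
    have "emeasure \<nu> A = emeasure (density ?S (\<lambda>x. ennreal (h x))) (A \<inter> sphere 0 1)"
      unfolding \<nu>_def by (subst emeasure_distr[OF id_meas A]) (simp add: vimage_def Int_def)
    also have "\<dots> = (\<integral>\<^sup>+x. ennreal (h x) * indicator (A \<inter> sphere 0 1) x \<partial>?S)"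
      using h_int borel_sphere_sets[OF A] by (intro emeasure_density) auto
    also have "\<dots> = (\<integral>\<^sup>+x. ennreal (indicator A x * h x) \<partial>?S)"
      by (intro nn_integral_cong) (auto split: split_indicator)
    also have "\<dots> = ennreal (\<integral>x. indicator A x * h x \<partial>?S)"
      by (rule nn_integral_eq_integral[OF ind_int[OF A] ind_nonneg])
    finally show ?thesis .
  qed
  have m_\<nu>: "measure \<nu> A = (\<integral>x. indicator A x * h x \<partial>?S)" if A: "A \<in> sets borel" for A
  proof -
    have "0 \<le> (\<integral>x. indicator A x * h x \<partial>?S)"
      by (rule integral_nonneg_AE[OF ind_nonneg])
    then show ?thesis by (simp add: measure_def em_\<nu>[OF A])
  qed
  have sp_\<nu>: "space \<nu> = UNIV" by (simp add: \<nu>_def)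
  have E_borel: "E \<in> sets borel" using \<open>compact E\<close> by (simp add: borel_compact)
  interpret \<nu>: finite_measure \<nu>
    by (rule finite_measureI) (simp add: sp_\<nu> em_\<nu>)
  interpret illuminated \<kappa> \<tau> r\<^sub>0 E K \<nu>
  proof
    show "sets \<nu> = sets borel" by (rule sets_\<nu>)
    have "(\<lambda>x. indicator (- E) x * h x) = (\<lambda>x. 0)"
      using \<Omega>_E by (auto simp: h_def fun_eq_iff split: split_indicator)
    with em_\<nu>[of "- E"] E_borel have "emeasure \<nu> (- E) = 0"
      by (simp only: borel_comp Bochner_Integration.integral_zero ennreal_0)
    then have "- E \<in> null_sets \<nu>" using E_borel by (intro null_setsI) (auto simp: sets_\<nu>)
    from AE_not_in[OF this] show "AE x in \<nu>. x \<in> E" by simp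
    show "N \<in> null_sets \<nu>"
      if N: "N \<in> sets borel" "N \<subseteq> E" "negligible {t *\<^sub>R x | t x. x \<in> N \<and> 0 < t \<and> t \<le> 1}" for N
    proof -
      have "N \<in> null_sets ?S"
        using N E_sphere by (intro null_sets_sphere_measure_if_negligible_cone) auto
      from AE_not_in[OF this] have "(\<integral>x. indicator N x * h x \<partial>?S) = (\<integral>x. 0 \<partial>?S)"
        by (intro integral_cong_AE borel_measurable_integrable[OF ind_int] N)
          (auto split: split_indicator)
      then show ?thesis using N by (intro null_setsI) (auto simp: sets_\<nu> em_\<nu>)
    qed
    show "0 < measure \<nu> (ball x e)" if x: "x \<in> E" "0 < e" for x e
    proof (rule ccontr)
      assume "\<not> ?thesis"
      then have "measure \<nu> (ball x e) = 0"
        using measure_nonneg[of \<nu> "ball x e"] by linarith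
      then have "(\<integral>y. indicator (ball x e) y * h y \<partial>?S) = 0" by (simp add: m_\<nu>)
      then have "AE y in ?S. indicator (ball x e) y * h y = 0"
        using integral_nonneg_eq_0_iff_AE[OF ind_int ind_nonneg, of "ball x e"] by simp
      with f_pos have "AE y in ?S. y \<notin> \<Omega> \<inter> ball x e"
        by eventually_elim (auto simp: h_def split: split_indicator)
      then have "\<Omega> \<inter> ball x e \<in> null_sets ?S"
        using \<Omega>_sphere by (subst S.null_sets_iff_AE) auto
      moreover have "openin (top_of_set (sphere 0 1)) (\<Omega> \<inter> ball x e)"
        using \<Omega>_open by (rule openin_Int_open) simp
      moreover have "\<Omega> \<inter> ball x e \<noteq> {}"
        using x closure_approachable[of x \<Omega>] unfolding E_def mem_ball disjoint_iff by (metis dist_commute)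
      ultimately show False using openin_sphere_not_null by blast
    qed
  qed
  have sets_\<mu>: "sets \<mu> = sets (restrict_space borel K)" and \<mu>_fin: "emeasure \<mu> K < \<infinity>"
    using \<mu>_radon K_compact by (auto simp: radon_measure_on_def K_def)
  have sp_\<mu>: "space \<mu> = K"
    using sets_eq_imp_space_eq[OF sets_\<mu>] by (simp add: space_restrict_space)
  have id_\<mu>: "(\<lambda>x. x) \<in> \<mu> \<rightarrow>\<^sub>M borel"
    unfolding measurable_cong_sets[OF sets_\<mu> refl] by (rule measurable_restrict_space1) simp
  define \<mu>' where "\<mu>' = distr \<mu> borel (\<lambda>x. x)"
  have m_\<mu>': "measure \<mu>' F = measure \<mu> (F \<inter> K)" if "F \<in> sets borel" for F
    unfolding \<mu>'_def by (subst measure_distr[OF id_\<mu> that]) (simp add: sp_\<mu> vimage_def Int_def)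
  interpret \<mu>: finite_measure \<mu>
    by (rule finite_measureI) (use \<mu>_fin sp_\<mu> in auto)
  have K_borel: "K \<in> sets borel" using K by (simp add: borel_compact)
  obtain x t where xt: "X\<^sub>0 = t *\<^sub>R x" "x \<in> E" "0 < t"
    using X0(1) by (auto simp: cone_region_def E_def)
  have x0: "x \<in> E" "X\<^sub>0 = norm X\<^sub>0 *\<^sub>R x"
    using xt by auto
  have a: "(1 + \<kappa>) * norm X\<^sub>0 < (1 - \<kappa>) * r\<^sub>0"
  proof -
    let ?q = "(1 - \<kappa>) / (1 + \<kappa>)"
    have q: "0 \<le> ?q" "?q \<le> 1" using kappa by auto
    have "?q ^ 3 \<le> ?q ^ 1" using q by (intro power_decreasing) auto
    then have "?q ^ 3 * r\<^sub>0 \<le> ?q * r\<^sub>0" using r0 by (intro mult_right_mono) auto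
    with X0(3) have "norm X\<^sub>0 < ?q * r\<^sub>0" by simp
    then show ?thesis using kappa by (simp add: field_simps)
  qed
  obtain \<rho> where ref: "refractor \<rho>" and le: "\<And>x. x \<in> E \<Longrightarrow> \<rho> x \<le> r\<^sub>0" and \<rho>x: "\<rho> x = norm X\<^sub>0"
    and push: "distr \<nu> borel (target \<rho>) = \<mu>'"
  proof (rule exists_refractor[of \<mu>' x "norm X\<^sub>0"])
    show "finite_measure \<mu>'" unfolding \<mu>'_def by (rule \<mu>.finite_measure_distr[OF id_\<mu>])
    show "sets \<mu>' = sets borel" by (simp add: \<mu>'_def)
    show "AE P in \<mu>'. P \<in> K"
      unfolding \<mu>'_def by (subst AE_distr_iff[OF id_\<mu>]) (use K_borel sp_\<mu> in auto)
    have "measure \<nu> UNIV = (LINT x:\<Omega>|?S. f x)"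
      by (simp add: m_\<nu> h_def set_lebesgue_integral_def)
    then show "measure \<mu>' UNIV = measure \<nu> UNIV"
      using balance by (simp add: m_\<mu>' K_def)
  qed (use x0 X0 a in auto)
  have pos: "0 < \<rho> y \<and> \<rho> y \<le> r\<^sub>0" if "y \<in> E" for y
    using ref le that by (auto simp: refractor_def)
  have map: "refractor_map \<kappa> \<Omega> D \<rho> y = {P \<in> K. active \<kappa> E \<rho> y P}" if "y \<in> E" for y
    using ex_oval_supports_iff_active[where \<rho> = \<rho>, OF E_def[symmetric] pos that]
    by (auto simp: refractor_map_def K_def)
  have nf: "near_field_refractor \<kappa> \<Omega> D r\<^sub>0 \<rho>"
    unfolding near_field_refractor_def
  proof (intro conjI ballI)
    show "0 < \<rho> y" if "y \<in> closure \<Omega>" for y using pos that by (simp add: E_def)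
    show "radial_surface \<Omega> \<rho> \<subseteq> cone_region \<Omega> r\<^sub>0"
      using pos by (auto simp: radial_surface_def cone_region_def E_def)
    fix y assume "y \<in> closure \<Omega>"
    then have y: "y \<in> E" by (simp add: E_def)
    then obtain P where P: "P \<in> K" "active \<kappa> E \<rho> y P"
      using ref by (auto simp: refractor_def)
    then have "\<exists>b. oval_supports \<kappa> \<Omega> P b \<rho> y"
      using ex_oval_supports_iff_active[where \<rho> = \<rho>, OF E_def[symmetric] pos y] by simp
    then show "\<exists>P\<in>closure D. \<exists>b. oval_supports \<kappa> \<Omega> P b \<rho> y"
      using P(1) unfolding K_def by blast
  qed
  have multi_S: "multi_active \<rho> \<in> null_sets ?S"
  proof (rule null_sets_sphere_measure_if_negligible_cone)
    show "multi_active \<rho> \<in> sets borel"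
      by (intro multi_active_borel refractor_continuous ref)
    show "negligible {t *\<^sub>R x | t x. x \<in> multi_active \<rho> \<and> 0 < t \<and> t \<le> 1}"
      using pos by (intro negligible_cone_multi_active) blast
  qed (use E_sphere in \<open>auto simp: multi_active_def\<close>)
  have T_meas: "target \<rho> \<in> borel_measurable borel"
    by (rule target_measurable[OF ref le])
  have "refractor_preimage \<kappa> \<Omega> D \<rho> F \<in> sets ?S \<and> refractor_measure \<kappa> \<Omega> D f \<rho> F = measure \<mu> F"
    if F: "F \<in> sets borel" "F \<subseteq> K" for F
  proof -
    let ?A = "refractor_preimage \<kappa> \<Omega> D \<rho> F"
    let ?T = "target \<rho> -` F"
    have A_eq: "?A = {y \<in> E. \<exists>P\<in>K \<inter> F. active \<kappa> E \<rho> y P}"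
      unfolding refractor_preimage_def using map by (auto simp: E_def)
    have T_borel: "?T \<in> sets borel"
      using measurable_sets[OF T_meas F(1)] by simp
    \<comment> \<open>Where the active target is unique, the multivalued and the single-valued preimage agree.\<close>
    have iff: "y \<in> ?T \<inter> E \<longleftrightarrow> y \<in> ?A" if "y \<notin> multi_active \<rho>" for y
    proof (cases "y \<in> E")
      case True
      have unique: "P = target \<rho> y" if "P \<in> K" "active \<kappa> E \<rho> y P" for P
        using \<open>y \<notin> multi_active \<rho>\<close> True le[OF True] that target[OF ref True \<open>y \<notin> multi_active \<rho>\<close>]
        unfolding multi_active_def by blast
      show ?thesis
      proof
        assume "y \<in> ?T \<inter> E"
        then show "y \<in> ?A"
          unfolding A_eq using target[OF ref True that] by blast
      next
        assume "y \<in> ?A"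
        then obtain P where "P \<in> K" "P \<in> F" "active \<kappa> E \<rho> y P" unfolding A_eq by blast
        with unique[of P] True show "y \<in> ?T \<inter> E" by simp
      qed
    qed (simp add: A_eq)
    have "?T \<inter> E \<inter> sphere 0 1 \<in> sets ?S"
      by (intro borel_sphere_sets sets.Int T_borel E_borel)
    then have A_sets: "?A \<in> sets ?S"
    proof (rule S.in_sets_AE[rotated])
      show "AE y in ?S. y \<in> ?T \<inter> E \<inter> sphere 0 1 \<longleftrightarrow> y \<in> ?A"
        using AE_not_in[OF multi_S]
      proof eventually_elim
        case (elim y)
        from iff[OF elim] show ?case using E_sphere by blast
      qed
      show "?A \<subseteq> space ?S" using E_sphere by (auto simp: A_eq)
    qed
    have ae: "AE y in ?S. indicator ?T y * h y = indicator ?A y * f y"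
      using AE_not_in[OF multi_S] AE_\<Omega>
    proof eventually_elim
      case (elim y)
      from iff[OF elim(1)] elim(2) \<Omega>_E show ?case
        by (auto simp: h_def A_eq split: split_indicator)
    qed
    have meas: "(\<lambda>y. indicator ?T y * h y) \<in> borel_measurable ?S"
      by (rule borel_measurable_integrable[OF ind_int[OF T_borel]])
    have "refractor_measure \<kappa> \<Omega> D f \<rho> F = (\<integral>y. indicator ?A y * f y \<partial>?S)"
      by (simp add: refractor_measure_def set_lebesgue_integral_def)
    also have "\<dots> = (\<integral>y. indicator ?T y * h y \<partial>?S)"
      using ae by (intro integral_cong_AE S.borel_measurable_if_AE_eq[OF meas ae] meas) auto
    also have "\<dots> = measure \<nu> ?T" using m_\<nu>[OF T_borel] by simp
    also have "\<dots> = measure (distr \<nu> borel (target \<rho>)) F"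
    proof -
      have "target \<rho> \<in> \<nu> \<rightarrow>\<^sub>M borel"
        using T_meas by (simp add: measurable_cong_sets[OF sets_\<nu>])
      from measure_distr[OF this F(1)] show ?thesis by (simp add: sp_\<nu>)
    qed
    also have "\<dots> = measure \<mu> F"
      using F by (simp add: push m_\<mu>' Int_absorb2)
    finally show ?thesis using A_sets by simp
  qed
  with nf have "weak_solution \<kappa> \<Omega> D r\<^sub>0 f \<mu> \<rho>"
    unfolding weak_solution_def by (simp add: K_def)
  moreover have "X\<^sub>0 \<in> radial_surface \<Omega> \<rho>"
  proof -
    have "X\<^sub>0 = \<rho> x *\<^sub>R x" unfolding \<rho>x by (rule x0(2))
    with x0(1) show ?thesis unfolding radial_surface_def E_def by blast
  qed
  ultimately show ?thesis by blast
qed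

end
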